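(* Let $-\infty<a<b<+\infty$, let $N\ge 3$ be an integer and $r\in[1,+\infty)$. Let $\mu$ be a probability measure on $\mathbb{R}$ with $\mu([a,b])=1$ and assume that $\mu$ is atomless. Then the function $L_N:\mathcal{S}^{a,b}_N\to\mathbb{R}_+$ is differentiable and its gradient $\nabla L_N$ admits a continuous extension to $\overline{\mathcal{S}}^{a,b}_N$. If, moreover, $\mu$ admits a density $f$ with respect to the Lebesgue measure which is positive and $\log$-concave on the interval $(a,b)$ and vanishes outside $(a,b)$, then the continuous extension of $\nabla L_N$ has a unique zero $x^\star$ in $\overline{\mathcal{S}}^{a,b}_N$, and $x^\star\in\mathcal{S}^{a,b}_N$.
   Context: $\mathcal{S}^{a,b}_N=\{(x_2,\ldots,x_{N-1})\in(a,b)^{N-2}: x_2<\cdots<x_{N-1}\}$, an open subset of $\mathbb{R}^{N-2}$, with closure $\overline{\mathcal{S}}^{a,b}_N=\{(x_2,\ldots,x_{N-1})\in[a,b]^{N-2}: x_2\le\cdots\le x_{N-1}\}$. For $x=(x_2,\ldots,x_{N-1})\in\mathcal{S}^{a,b}_N$, with the convention $x_1=a$ and $x_N=b$, the ($r$-th power of the $L^r$) dual quantization error is $$L_N(x)=\sum_{i=1}^{N-1}\int_{(x_i,x_{i+1})}\Big((\xi-x_i)^r\frac{x_{i+1}-\xi}{x_{i+1}-x_i}+(x_{i+1}-\xi)^r\frac{\xi-x_i}{x_{i+1}-x_i}\Big)\mu(d\xi).$$ "Positive and $\log$-concave on $(a,b)$" means $f>0$ on $(a,b)$ and $\log f$ is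 concave on $(a,b)$. *)

theory Defs
  imports "HOL-Probability.Probability"
begin

text \<open>
  The space of tuples \<open>(x\<^sub>2, \<dots>, x\<^bsub>N-1\<^esub>)\<close> is \<open>real ^ 'n\<close>. A bijection \<open>e\<close> from \<open>{2..N-1}\<close> onto
  the index type \<open>'n\<close> numbers the coordinates, so that the coordinate \<open>x\<^sub>i\<close> is \<open>x $ e i\<close> (and
  \<open>CARD('n) = N - 2\<close>).
\<close>

definition ordered_simplex :: "real \<Rightarrow> real \<Rightarrow> nat \<Rightarrow> (nat \<Rightarrow> 'n::finite) \<Rightarrow> (real ^ 'n) set" where
  "ordered_simplex a b N e =
     {x. (\<forall>i\<in>{2..N-1}. x $ e i \<in> {a<..<b}) \<and> strict_mono_on {2..N-1} (\<lambda>i. x $ e i)}"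

definition closed_ordered_simplex :: "real \<Rightarrow> real \<Rightarrow> nat \<Rightarrow> (nat \<Rightarrow> 'n::finite) \<Rightarrow> (real ^ 'n) set" where
  "closed_ordered_simplex a b N e =
     {x. (\<forall>i\<in>{2..N-1}. x $ e i \<in> {a..b}) \<and> mono_on {2..N-1} (\<lambda>i. x $ e i)}"

text \<open>The grid points \<open>x\<^sub>1, \<dots>, x\<^sub>N\<close>, with the convention \<open>x\<^sub>1 = a\<close> and \<open>x\<^sub>N = b\<close>.\<close>

definition node :: "real \<Rightarrow> real \<Rightarrow> nat \<Rightarrow> (nat \<Rightarrow> 'n::finite) \<Rightarrow> real ^ 'n \<Rightarrow> nat \<Rightarrow> real" where
  "node a b N e x i = (if i = 1 then a else if i = N then b else x $ e i)"

definition dual_quant_error ::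
    "real \<Rightarrow> real \<Rightarrow> real \<Rightarrow> nat \<Rightarrow> (nat \<Rightarrow> 'n::finite) \<Rightarrow> real measure \<Rightarrow> real ^ 'n \<Rightarrow> real" where
  "dual_quant_error r a b N e \<mu> x =
     (\<Sum>i = 1..N-1.
        let u = node a b N e x i; v = node a b N e x (i + 1) in
        LINT \<xi>:{u<..<v}|\<mu>.
          (\<xi> - u) powr r * ((v - \<xi>) / (v - u)) + (v - \<xi>) powr r * ((\<xi> - u) / (v - u)))"

text \<open>\<open>G\<close>, restricted to \<open>T\<close>, is a continuous extension to \<open>T\<close> of the gradient of \<open>L\<close> on \<open>S\<close>.\<close>

definition continuous_gradient_extension ::
    "('v::real_inner \<Rightarrow> real) \<Rightarrow> 'v set \<Rightarrow> 'v set \<Rightarrow> ('v \<Rightarrow> 'v) \<Rightarrow> bool" where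
  "continuous_gradient_extension L S T G \<longleftrightarrow>
     continuous_on T G \<and> (\<forall>x\<in>S. GDERIV L x :> G x)"

lemma closure_ordered_simplex:
  fixes e :: "nat \<Rightarrow> 'n::finite"
  assumes ab: "a < b" and N: "3 \<le> N" and e: "bij_betw e {2..N-1} UNIV"
  shows "closure (ordered_simplex a b N e) = closed_ordered_simplex a b N e"
proof
  have eq: "closed_ordered_simplex a b N e =
      (\<Inter>i\<in>{2..N-1}. {x. a \<le> x $ e i} \<inter> {x. x $ e i \<le> b}) \<inter>
      (\<Inter>(i,j)\<in>{(i,j). i \<in> {2..N-1} \<and> j \<in> {2..N-1} \<and> i \<le> j}. {x. x $ e i \<le> x $ e j})"
    by (auto simp: closed_ordered_simplex_def mono_on_def)
  have "closed (closed_ordered_simplex a b N e)"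
    unfolding eq
    by (intro closed_Int closed_INT ballI)
       (auto simp del: Collect_conj_eq intro!: closed_Collect_le continuous_intros)
  moreover have "ordered_simplex a b N e \<subseteq> closed_ordered_simplex a b N e"
    unfolding ordered_simplex_def closed_ordered_simplex_def
    by (auto simp: less_imp_le intro: strict_mono_on_imp_mono_on)
  ultimately show "closure (ordered_simplex a b N e) \<subseteq> closed_ordered_simplex a b N e"
    by (rule closure_minimal[rotated])
next
  show "closed_ordered_simplex a b N e \<subseteq> closure (ordered_simplex a b N e)"
  proof
    fix x assume x: "x \<in> closed_ordered_simplex a b N e"
    define q where "q i = a + (b - a) * (real i / real N)" for i
    define p :: "real ^ 'n" where "p = (\<chi> k. q (the_inv_into {2..N-1} e k))"
    have p: "p $ e i = q i" if "i \<in> {2..N-1}" for i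
      using e that by (simp add: p_def bij_betw_def the_inv_into_f_f)
    have q_mono: "q i < q j" if "i < j" for i j
      using ab N that unfolding q_def by (simp add: divide_strict_right_mono)
    have "q 0 = a" "q N = b" using N by (auto simp: q_def)
    then have q: "a < q i" "q i < b" if "i \<in> {2..N-1}" for i
      using q_mono[of 0 i] q_mono[of i N] that N by auto
    define y where "y n = x + inverse (real (Suc n)) *\<^sub>R (p - x)" for n
    have "(\<lambda>n. inverse (real (Suc n))) \<longlonglongrightarrow> 0"
      by (rule LIMSEQ_inverse_real_of_nat)
    then have "y \<longlonglongrightarrow> x + 0 *\<^sub>R (p - x)"
      unfolding y_def by (intro tendsto_intros)
    then have lim: "y \<longlonglongrightarrow> x" by simp
    have "y n \<in> ordered_simplex a b N e" for n
    proof -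
      define t where "t = inverse (real (Suc n))"
      have t: "0 < t" "t \<le> 1" by (auto simp: t_def divide_simps)
      have y: "y n $ e i = (1 - t) * x $ e i + t * q i" if "i \<in> {2..N-1}" for i
        using p[OF that] unfolding y_def t_def[symmetric] by (simp add: algebra_simps)
      have conv: "(1 - t) * c + t * d < (1 - t) * c' + t * d'"
        if "c \<le> c'" "d < d'" for c d c' d' :: real
        using t that by (intro add_le_less_mono mult_left_mono mult_strict_left_mono) auto
      have ba: "a \<le> x $ e i" "x $ e i \<le> b" if "i \<in> {2..N-1}" for i
        using x that by (auto simp: closed_ordered_simplex_def)
      have "a < y n $ e i" "y n $ e i < b" if "i \<in> {2..N-1}" for i
        using conv[OF ba(1)[OF that] q(1)[OF that]] conv[OF ba(2)[OF that] q(2)[OF that]] y[OF that]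
        by (auto simp: algebra_simps)
      moreover have "y n $ e i < y n $ e j" if "i \<in> {2..N-1}" "j \<in> {2..N-1}" "i < j" for i j
      proof -
        have "x $ e i \<le> x $ e j"
          using x that by (auto simp: closed_ordered_simplex_def mono_on_def)
        from conv[OF this q_mono[OF \<open>i < j\<close>]] show ?thesis
          using y that by simp
      qed
      ultimately show ?thesis
        by (auto simp: ordered_simplex_def strict_mono_on_def)
    qed
    with lim show "x \<in> closure (ordered_simplex a b N e)"
      unfolding closure_sequential by blast
  qed
qed

end

theory Submission
  imports Defs
begin

text \<open>
  Write \<open>A(u,v)\<close> and \<open>-B(u,v)\<close> for the partial derivatives in \<open>v\<close> and \<open>u\<close> of the error of a cell
  \<open>(u,v)\<close>. They exist because the integrand is Lipschitz in \<open>(u,v)\<close> and \<open>\<mu>\<close> has no atoms, and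
  \<open>\<nabla>L\<^sub>N(x)\<^sub>i = A(x\<^bsub>i-1\<^esub>,x\<^sub>i) - B(x\<^sub>i,x\<^bsub>i+1\<^esub>)\<close>; dominated convergence extends it continuously, with
  \<open>A = B = 0\<close> on degenerate cells. If \<open>\<mu>\<close> has full support, \<open>A\<close> and \<open>B\<close> vanish only on degenerate
  cells, so at a zero one coincidence \<open>x\<^sub>i = x\<^bsub>i+1\<^esub>\<close> would propagate and give \<open>a = b\<close>. A zero exists at
  a minimizer of \<open>L\<^sub>N\<close>, which is interior because splitting a cell lowers the error.

  Uniqueness is a shooting argument. \<open>A\<close> and \<open>B\<close> increase strictly when the cell is enlarged away
  from the fixed node, and by log-concavity \<open>f(z+s)/f(z)\<close> decreases in \<open>z\<close>, so a shift to the right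
  by \<open>s\<close> multiplies \<open>A(c-h,c)\<close> by at least, and \<open>B(c,c+h)\<close> by at most, \<open>f(c+s)/f(c)\<close>. Hence, of two
  zeros with different first gaps, the one with the larger first gap has all gaps larger, which is
  impossible as the gaps of both add up to \<open>b - a\<close>; and equal first gaps force equal gaps throughout.
\<close>

section \<open>The integrand of one cell and its partial derivatives\<close>

text \<open>The integrand of \<open>dual_quant_error\<close> on a cell \<open>(u, v)\<close>,
  written in the distances \<open>p = \<xi> - u\<close> and \<open>q = v - \<xi>\<close>, so that
  \<open>p + q = v - u\<close>. It is symmetric, so one partial derivative yields both.\<close>

definition cell_err :: "real \<Rightarrow> real \<Rightarrow> real \<Rightarrow> real" where
  "cell_err r p q = (p powr r * q + q powr r * p) / (p + q)"

text \<open>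
  The partial derivative of \<^const>\<open>cell_err\<close> in \<open>q\<close> for positive \<open>p\<close> and \<open>q\<close>, in a form in which the
  sign and the monotonicity in \<open>p\<close> are apparent.
\<close>

definition cell_slope :: "real \<Rightarrow> real \<Rightarrow> real \<Rightarrow> real" where
  "cell_slope r p q =
     (p / (p + q))\<^sup>2 * p powr (r - 1) + p / (p + q) * (r - 1 + p / (p + q)) * q powr (r - 1)"

lemma cell_err_commute: "cell_err r p q = cell_err r q p"
  by (simp add: cell_err_def add.commute)

text \<open>The numerator vanishes because \<open>0 powr r = 0\<close>. Hence truncating the
  distances at zero has the same effect as cutting the integrand off outside the cell.\<close>

lemma cell_err_0 [simp]: "cell_err r p 0 = 0" "cell_err r 0 p = 0"
  by (simp_all add: cell_err_def)

text \<open>The right-hand side is what the quotient rule gives for \<open>cell_err\<close>; once a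
  factor \<open>p\<close> or \<open>q\<close> is split off the \<open>r\<close>-th powers, the
  identity is rational.\<close>

lemma cell_slope_eq:
  assumes "p > 0" "q > 0"
  shows "cell_slope r p q =
    ((p powr r + r * q powr (r - 1) * p) * (p + q) - (p powr r * q + q powr r * p)) / (p + q)\<^sup>2"
proof -
  have pw: "p powr r = p * p powr (r - 1)" "q powr r = q * q powr (r - 1)"
    using assms by (simp_all add: powr_mult_base)
  have "p + q \<noteq> 0" using assms by simp
  then show ?thesis
    unfolding cell_slope_def pw by (simp add: divide_simps power2_eq_square, algebra)
qed

text \<open>By symmetry the slope in \<open>p\<close> is \<open>cell_slope\<close> with its
  arguments exchanged, and \<open>p = \<xi> - u\<close> brings the minus sign.\<close>

lemma has_derivative_cell_err:
  assumes "u < \<xi>" "\<xi> < v"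
  shows "((\<lambda>z. cell_err r (\<xi> - fst z) (snd z - \<xi>)) has_derivative
    (\<lambda>d. d \<bullet> (- cell_slope r (v - \<xi>) (\<xi> - u), cell_slope r (\<xi> - u) (v - \<xi>)))) (at (u, v))"
proof -
  define p q where "p = \<xi> - u" and "q = v - \<xi>"
  have pq: "p > 0" "q > 0" using assms by (auto simp: p_def q_def)
  have powr': "((\<lambda>z. g z powr r) has_derivative (\<lambda>d. g' d * (r * g z powr (r - 1)))) (at z)"
    if "g z > 0" "(g has_derivative g') (at z)" for g g' and z :: "real \<times> real"
    using DERIV_compose_FDERIV[OF has_real_derivative_powr that(2)] that(1) by blast
  have p: "((\<lambda>z. \<xi> - fst z) has_derivative (\<lambda>d. - fst d)) (at (u, v))"
    and q: "((\<lambda>z. snd z - \<xi>) has_derivative snd) (at (u, v))"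
    by (auto intro!: derivative_eq_intros)
  have P: "((\<lambda>z. (\<xi> - fst z) powr r) has_derivative (\<lambda>d. - fst d * (r * p powr (r - 1)))) (at (u, v))"
    and Q: "((\<lambda>z. (snd z - \<xi>) powr r) has_derivative (\<lambda>d. snd d * (r * q powr (r - 1)))) (at (u, v))"
    using powr'[OF _ p] powr'[OF _ q] pq by (simp_all add: p_def q_def)
  have "((\<lambda>z. cell_err r (\<xi> - fst z) (snd z - \<xi>)) has_derivative
     (\<lambda>d. ((p powr r * snd d + (- fst d * (r * p powr (r - 1))) * q
        + (q powr r * - fst d + (snd d * (r * q powr (r - 1))) * p)) * (p + q)
        - (p powr r * q + q powr r * p) * (- fst d + snd d)) / ((p + q) * (p + q)))) (at (u, v))"
    using has_derivative_divide'[OF has_derivative_add[OF has_derivative_mult[OF P q]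
      has_derivative_mult[OF Q p]] has_derivative_add[OF p q]] pq assms
    unfolding cell_err_def p_def q_def fst_conv snd_conv by auto
  also have "(\<lambda>d. ((p powr r * snd d + (- fst d * (r * p powr (r - 1))) * q
        + (q powr r * - fst d + (snd d * (r * q powr (r - 1))) * p)) * (p + q)
        - (p powr r * q + q powr r * p) * (- fst d + snd d)) / ((p + q) * (p + q)))
     = (\<lambda>d. d \<bullet> (- cell_slope r q p, cell_slope r p q))"
  proof
    fix d :: "real \<times> real"
    have "d \<bullet> (- cell_slope r q p, cell_slope r p q)
      = (snd d * ((p powr r + r * q powr (r - 1) * p) * (p + q) - (p powr r * q + q powr r * p))
        - fst d * ((q powr r + r * p powr (r - 1) * q) * (p + q) - (p powr r * q + q powr r * p)))
        / ((p + q) * (p + q))"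
      using pq unfolding diff_divide_distrib
      by (simp add: cell_slope_eq inner_prod_def power2_eq_square add.commute)
    also have "snd d * ((p powr r + r * q powr (r - 1) * p) * (p + q) - (p powr r * q + q powr r * p))
        - fst d * ((q powr r + r * p powr (r - 1) * q) * (p + q) - (p powr r * q + q powr r * p))
      = (p powr r * snd d + (- fst d * (r * p powr (r - 1))) * q
        + (q powr r * - fst d + (snd d * (r * q powr (r - 1))) * p)) * (p + q)
        - (p powr r * q + q powr r * p) * (- fst d + snd d)"
      by algebra
    finally show "((p powr r * snd d + (- fst d * (r * p powr (r - 1))) * q
        + (q powr r * - fst d + (snd d * (r * q powr (r - 1))) * p)) * (p + q)
        - (p powr r * q + q powr r * p) * (- fst d + snd d)) / ((p + q) * (p + q))
      = d \<bullet> (- cell_slope r q p, cell_slope r p q)" by simp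
  qed
  finally show ?thesis by (simp add: p_def q_def)
qed

lemma has_real_derivative_cell_err:
  assumes "p > 0" "q > 0"
  shows "(cell_err r p has_real_derivative cell_slope r p q) (at q)"
  unfolding cell_err_def[abs_def] cell_slope_eq[OF assms] using assms
  by (auto intro!: derivative_eq_intros simp: field_simps power2_eq_square)

lemma cell_slope_pos:
  assumes "r \<ge> 1" "p > 0" "q > 0"
  shows "cell_slope r p q > 0"
  unfolding cell_slope_def using assms by (intro add_pos_nonneg) auto

text \<open>The ratio \<open>p / (p + q)\<close> has no limit at the origin but stays in
  \<open>[0, 1]\<close>, so the two summands are at most \<open>M powr (r - 1)\<close> and
  \<open>r * M powr (r - 1)\<close>.\<close>

lemma cell_slope_le:
  assumes r: "r \<ge> 1" and p: "0 < p" "p \<le> M" and q: "0 < q" "q \<le> M"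
  shows "cell_slope r p q \<le> (r + 1) * M powr (r - 1)"
proof -
  define t where "t = p / (p + q)"
  have t: "0 \<le> t" "t \<le> 1" using p q by (auto simp: t_def)
  have "t\<^sup>2 * p powr (r - 1) \<le> 1 * M powr (r - 1)"
    using t p r by (intro mult_mono powr_mono2) (auto simp: power_le_one)
  moreover have "t * (r - 1 + t) * q powr (r - 1) \<le> (1 * r) * M powr (r - 1)"
    using t p r q by (intro mult_mono powr_mono2) auto
  ultimately show ?thesis
    unfolding cell_slope_def t_def[symmetric] by (simp add: algebra_simps)
qed

text \<open>The ratio \<open>p / (p + q)\<close> increases strictly with \<open>p\<close>, and the
  remaining factors do not decrease since \<open>r \<ge> 1\<close>.\<close>

lemma cell_slope_strict_mono:
  assumes r: "r \<ge> 1" and p: "0 < p" "p < p'" and q: "0 < q"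
  shows "cell_slope r p q < cell_slope r p' q"
proof -
  define t t' where "t = p / (p + q)" and "t' = p' / (p' + q)"
  have t: "0 < t" "t < t'" using p q by (auto simp: t_def t'_def field_simps)
  have "t\<^sup>2 < t'\<^sup>2" using t by (simp add: power_strict_mono)
  moreover have "p powr (r - 1) \<le> p' powr (r - 1)" using p r by (intro powr_mono2) auto
  ultimately have "t\<^sup>2 * p powr (r - 1) < t'\<^sup>2 * p' powr (r - 1)"
    using t p by (intro mult_less_le_imp_less) auto
  moreover have "t * (r - 1 + t) * q powr (r - 1) \<le> t' * (r - 1 + t') * q powr (r - 1)"
    using t r by (intro mult_right_mono mult_mono) auto
  ultimately show ?thesis
    unfolding cell_slope_def t_def[symmetric] t'_def[symmetric] by linarith
qed

lemma cell_err_strict_mono: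
  assumes "r \<ge> 1" "p > 0" "0 < q" "q < q'"
  shows "cell_err r p q < cell_err r p q'"
  using assms cell_slope_pos has_real_derivative_cell_err
  by (intro DERIV_pos_imp_increasing[OF \<open>q < q'\<close>]) (meson less_le_trans)

text \<open>Mean value theorem with the bound of \<open>cell_slope_le\<close>. Slopes are available
  for positive distances only: \<open>q = 0\<close> enters as an endpoint through continuity, and at
  \<open>p = 0\<close> the function \<open>cell_err\<close> vanishes.\<close>

lemma cell_err_lipschitz_right:
  assumes r: "r \<ge> 1" and p: "0 \<le> p" "p \<le> M" and q: "0 \<le> q" "q \<le> M" "0 \<le> q'" "q' \<le> M"
  shows "\<bar>cell_err r p q - cell_err r p q'\<bar> \<le> (r + 1) * M powr (r - 1) * \<bar>q - q'\<bar>"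
proof -
  have *: "\<bar>cell_err r p q - cell_err r p q'\<bar> \<le> (r + 1) * M powr (r - 1) * \<bar>q - q'\<bar>"
    if p: "p > 0" and q: "0 \<le> q" "q < q'" "q' \<le> M" for q q'
  proof -
    have "continuous_on {q..q'} (cell_err r p)"
      unfolding cell_err_def[abs_def] using p q r
      by (intro continuous_intros continuous_on_powr') auto
    moreover have "cell_err r p differentiable (at x)" if "q < x" "x < q'" for x
      using has_real_derivative_cell_err[OF p, of x r] that q
      by (auto simp: real_differentiable_def)
    ultimately obtain l z where z: "q < z" "z < q'" "DERIV (cell_err r p) z :> l"
        "cell_err r p q' - cell_err r p q = (q' - q) * l"
      using MVT[OF \<open>q < q'\<close>] by meson
    have "l = cell_slope r p z"
      using z q has_real_derivative_cell_err[OF p, of z r] by (intro DERIV_unique[OF z(3)]) auto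
    then have "0 < l" "l \<le> (r + 1) * M powr (r - 1)"
      using cell_slope_pos[of r p z] cell_slope_le[of r p M z] z q r p \<open>p \<le> M\<close> by auto
    then have "(q' - q) * l \<le> (q' - q) * ((r + 1) * M powr (r - 1))" "0 \<le> (q' - q) * l"
      using z q by (auto intro!: mult_left_mono)
    then show ?thesis using z q by (simp add: algebra_simps)
  qed
  show ?thesis
  proof (cases "p = 0")
    case True
    then show ?thesis using r by simp
  next
    case False
    then show ?thesis
      using *[of q q'] *[of q' q] p q by (cases q q' rule: linorder_cases) (auto simp: abs_minus_commute)
  qed
qed

lemma cell_err_lipschitz:
  assumes r: "r \<ge> 1" and "0 \<le> p" "p \<le> M" "0 \<le> p'" "p' \<le> M" "0 \<le> q" "q \<le> M" "0 \<le> q'" "q' \<le> M"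
  shows "\<bar>cell_err r p q - cell_err r p' q'\<bar> \<le> (r + 1) * M powr (r - 1) * (\<bar>p - p'\<bar> + \<bar>q - q'\<bar>)"
  using cell_err_lipschitz_right[of r p M q q'] cell_err_lipschitz_right[of r q' M p p'] assms
  unfolding cell_err_commute[of r q'] distrib_left by linarith

section \<open>Kernels that can be integrated over a cell\<close>

text \<open>
  An integrand \<open>k (\<xi> - u) (v - \<xi>)\<close> over the cell \<open>(u, v)\<close>; only the values of \<open>k\<close> on the open
  positive quadrant matter.
\<close>

definition cell_kernel :: "(real \<Rightarrow> real \<Rightarrow> real) \<Rightarrow> bool" where
  "cell_kernel k \<longleftrightarrow> continuous_on ({0<..} \<times> {0<..}) (\<lambda>(p, q). k p q) \<and>
     (\<forall>M. \<exists>C\<ge>0. \<forall>p q. 0 < p \<and> p \<le> M \<and> 0 < q \<and> q \<le> M \<longrightarrow> \<bar>k p q\<bar> \<le> C)"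

lemma cell_kernel_cell_slope:
  assumes "r \<ge> 1"
  shows "cell_kernel (cell_slope r)"
  unfolding cell_kernel_def
proof (intro conjI allI)
  show "continuous_on ({0<..} \<times> {0<..}) (\<lambda>(p, q). cell_slope r p q)"
    unfolding cell_slope_def case_prod_unfold
    by (intro continuous_intros) auto
  show "\<exists>C\<ge>0. \<forall>p q. 0 < p \<and> p \<le> M \<and> 0 < q \<and> q \<le> M \<longrightarrow> \<bar>cell_slope r p q\<bar> \<le> C" for M
    using cell_slope_le[OF assms] cell_slope_pos[OF assms] assms
    by (intro exI[of _ "(r + 1) * M powr (r - 1)"]) (auto simp: abs_of_pos)
qed

lemma cell_kernel_cell_err:
  assumes "r \<ge> 1"
  shows "cell_kernel (cell_err r)"
  unfolding cell_kernel_def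
proof (intro conjI allI)
  show "continuous_on ({0<..} \<times> {0<..}) (\<lambda>(p, q). cell_err r p q)"
    unfolding cell_err_def case_prod_unfold
    by (intro continuous_intros) auto
  show "\<exists>C\<ge>0. \<forall>p q. 0 < p \<and> p \<le> M \<and> 0 < q \<and> q \<le> M \<longrightarrow> \<bar>cell_err r p q\<bar> \<le> C" for M
  proof (intro exI conjI allI impI)
    \<comment> \<open>The bound comes from the Lipschitz estimate against the value zero at
      \<open>q = 0\<close>; the absolute value keeps it nonnegative for negative \<open>M\<close> as
      well.\<close>
    show "0 \<le> (r + 1) * M powr (r - 1) * \<bar>M\<bar>" using assms by simp
    fix p q :: real assume pq: "0 < p \<and> p \<le> M \<and> 0 < q \<and> q \<le> M"
    then have "\<bar>cell_err r p q - cell_err r p 0\<bar> \<le> (r + 1) * M powr (r - 1) * \<bar>q - 0\<bar>"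
      using assms by (intro cell_err_lipschitz_right) auto
    also have "\<dots> \<le> (r + 1) * M powr (r - 1) * \<bar>M\<bar>"
      using pq assms by (intro mult_left_mono) auto
    finally show "\<bar>cell_err r p q\<bar> \<le> (r + 1) * M powr (r - 1) * \<bar>M\<bar>" by simp
  qed
qed

lemma cell_kernel_flip:
  assumes "cell_kernel k"
  shows "cell_kernel (\<lambda>p q. k q p)"
  unfolding cell_kernel_def
proof (intro conjI allI)
  have "continuous_on ({0<..} \<times> {0<..}) (\<lambda>z. (\<lambda>(p, q). k p q) (snd z, fst z))"
    by (rule continuous_on_compose2[OF conjunct1[OF assms[unfolded cell_kernel_def]]])
      (auto intro!: continuous_intros)
  then show "continuous_on ({0<..} \<times> {0<..}) (\<lambda>(p, q). k q p)"
    by (simp add: case_prod_unfold)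
  show "\<exists>C\<ge>0. \<forall>p q. 0 < p \<and> p \<le> M \<and> 0 < q \<and> q \<le> M \<longrightarrow> \<bar>k q p\<bar> \<le> C" for M
    using spec[OF conjunct2[OF assms[unfolded cell_kernel_def]], of M] by auto
qed

section \<open>Differentiation under the integral sign\<close>

text \<open>Dominated convergence for the difference quotients \<open>Q\<close>: they tend to zero
  almost everywhere, and the Lipschitz bound with Cauchy-Schwarz dominates them by
  \<open>C + norm (g s)\<close>. Differentiability is asked only at \<open>x\<close> and for almost
  every \<open>s\<close>, which admits integrands with a kink at a moving cell end.\<close>

lemma has_derivative_integral_lipschitz:
  fixes F :: "'v::euclidean_space \<Rightarrow> 's \<Rightarrow> real" and g :: "'s \<Rightarrow> 'v"
  assumes M: "finite_measure M"
    and F: "\<And>z. integrable M (F z)" and g: "integrable M g"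
    and deriv: "AE s in M. ((\<lambda>z. F z s) has_derivative (\<lambda>d. d \<bullet> g s)) (at x)"
    and lip: "AE s in M. \<forall>z\<in>ball x \<delta>. \<bar>F z s - F x s\<bar> \<le> C * norm (z - x)" and \<delta>: "\<delta> > 0"
  shows "((\<lambda>z. \<integral>s. F z s \<partial>M) has_derivative (\<lambda>d. d \<bullet> (\<integral>s. g s \<partial>M))) (at x)"
proof -
  interpret finite_measure M by (rule M)
  define Q where "Q z s = (F z s - F x s - (z - x) \<bullet> g s) / norm (z - x)" for z s
  have intQ: "integrable M (Q z)" for z
    unfolding Q_def using F g by (intro integrable_divide Bochner_Integration.integrable_diff) auto
  have Q: "((\<integral>s. F z s \<partial>M) - (\<integral>s. F x s \<partial>M) - (z - x) \<bullet> (\<integral>s. g s \<partial>M)) / norm (z - x)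
      = (\<integral>s. Q z s \<partial>M)" for z
    unfolding Q_def using F g by simp
  \<comment> \<open>The limit is taken within the ball so that the Lipschitz bound covers every term
    of an approximating sequence.\<close>
  have "((\<lambda>z. \<integral>s. Q z s \<partial>M) \<longlongrightarrow> 0) (at x within ball x \<delta>)"
    unfolding tendsto_at_iff_sequentially
  proof (intro allI impI)
    fix X assume X: "\<forall>i. X i \<in> ball x \<delta> - {x}" "X \<longlonglongrightarrow> x"
    have "(\<lambda>i. \<integral>s. Q (X i) s \<partial>M) \<longlonglongrightarrow> (\<integral>s. 0 \<partial>M)"
    proof (rule integral_dominated_convergence)
      show "integrable M (\<lambda>s. C + norm (g s))" using g by simp
      show "Q (X i) \<in> borel_measurable M" for i
        using intQ by (rule borel_measurable_integrable)
      show "AE s in M. (\<lambda>i. Q (X i) s) \<longlonglongrightarrow> 0"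
        using deriv
      proof eventually_elim
        case (elim s)
        then have "((\<lambda>z. norm (F z s - F x s - (z - x) \<bullet> g s) / norm (z - x)) \<longlongrightarrow> 0) (at x)"
          by (rule has_derivative_iff_norm[THEN iffD1, THEN conjunct2])
        then have "((\<lambda>z. norm (Q z s)) \<longlongrightarrow> 0) (at x within ball x \<delta>)"
          unfolding Q_def real_norm_def abs_divide abs_norm_cancel by (rule tendsto_within_subset) simp
        then have "((\<lambda>z. Q z s) \<longlongrightarrow> 0) (at x within ball x \<delta>)"
          by (rule tendsto_norm_zero_cancel)
        then have "((\<lambda>z. Q z s) \<circ> X) \<longlonglongrightarrow> 0"
          by (rule tendsto_at_iff_sequentially[THEN iffD1, rule_format]) (use X in auto)
        then show ?case by (simp add: comp_def)
      qed
      show "AE s in M. norm (Q (X i) s) \<le> C + norm (g s)" for i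
        using lip
      proof eventually_elim
        case (elim s)
        have "X i \<in> ball x \<delta>" "norm (X i - x) > 0" using X by auto
        have "\<bar>F (X i) s - F x s - (X i - x) \<bullet> g s\<bar> \<le> \<bar>F (X i) s - F x s\<bar> + \<bar>(X i - x) \<bullet> g s\<bar>"
          by linarith
        also have "\<dots> \<le> C * norm (X i - x) + norm (X i - x) * norm (g s)"
          using elim \<open>X i \<in> ball x \<delta>\<close> by (intro add_mono Cauchy_Schwarz_ineq2) blast
        also have "\<dots> = (C + norm (g s)) * norm (X i - x)"
          by (simp add: algebra_simps)
        finally show ?case
          using \<open>norm (X i - x) > 0\<close> by (simp add: Q_def pos_divide_le_eq)
      qed
    qed simp
    then show "((\<lambda>z. \<integral>s. Q z s \<partial>M) \<circ> X) \<longlonglongrightarrow> 0" by (simp add: comp_def)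
  qed
  then have "((\<lambda>z. \<integral>s. Q z s \<partial>M) \<longlongrightarrow> 0) (at x)"
    using \<delta> by (simp add: at_within_open[of x "ball x \<delta>"])
  then have "((\<lambda>z. norm (\<integral>s. Q z s \<partial>M)) \<longlongrightarrow> 0) (at x)"
    by (rule tendsto_norm_zero)
  then show ?thesis
    unfolding Q[symmetric] by (simp add: has_derivative_iff_norm bounded_linear_inner_left)
qed

section \<open>Cell integrals for an atomless measure\<close>

definition cell_int :: "real measure \<Rightarrow> (real \<Rightarrow> real \<Rightarrow> real) \<Rightarrow> real \<Rightarrow> real \<Rightarrow> real" where
  "cell_int \<mu> k u v = (LINT \<xi>:{u<..<v}|\<mu>. k (\<xi> - u) (v - \<xi>))"

lemma cell_int_empty [simp]: "v \<le> u \<Longrightarrow> cell_int \<mu> k u v = 0"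
  by (simp add: cell_int_def set_lebesgue_integral_def)

locale atomless_on_interval = prob_space \<mu> for \<mu> :: "real measure" +
  fixes a b :: real
  assumes ab: "a < b"
    and sets_eq [measurable_cong]: "sets \<mu> = sets borel"
    and carrier: "measure \<mu> {a..b} = 1"
    and atomless: "\<And>t. measure \<mu> {t} = 0"
begin

lemma space_eq [simp]: "space \<mu> = UNIV"
  using sets_eq_imp_space_eq[OF sets_eq] by simp

lemma AE_interval: "AE \<xi> in \<mu>. \<xi> \<in> {a..b}"
  using AE_prob_1[OF carrier] .

lemma AE_neq: "AE \<xi> in \<mu>. \<xi> \<noteq> t"
proof (rule AE_I)
  show "emeasure \<mu> {t} = 0" using atomless[of t] by (simp add: emeasure_eq_measure)
qed (auto simp: sets_eq)

lemma set_integrable_cell: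
  assumes "cell_kernel k"
  shows "set_integrable \<mu> {u<..<v} (\<lambda>\<xi>. k (\<xi> - u) (v - \<xi>))"
proof -
  obtain C where C: "C \<ge> 0" "\<And>p q. 0 < p \<Longrightarrow> p \<le> v - u \<Longrightarrow> 0 < q \<Longrightarrow> q \<le> v - u \<Longrightarrow> \<bar>k p q\<bar> \<le> C"
    using assms unfolding cell_kernel_def by meson
  have "continuous_on {u<..<v} (\<lambda>\<xi>. (\<lambda>(p, q). k p q) (\<xi> - u, v - \<xi>))"
    by (rule continuous_on_compose2[OF conjunct1[OF assms[unfolded cell_kernel_def]]])
      (auto intro!: continuous_intros)
  then have m: "(\<lambda>\<xi>. indicator {u<..<v} \<xi> *\<^sub>R k (\<xi> - u) (v - \<xi>)) \<in> borel_measurable borel"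
    using borel_measurable_continuous_on_indicator[of "{u<..<v}" "\<lambda>\<xi>. k (\<xi> - u) (v - \<xi>)"] by simp
  have "(\<lambda>\<xi>. indicator {u<..<v} \<xi> *\<^sub>R k (\<xi> - u) (v - \<xi>)) \<in> borel_measurable \<mu>"
    using m measurable_cong_sets[OF sets_eq refl] by blast
  then show ?thesis
    unfolding set_integrable_def using C
    by (intro integrable_const_bound[of _ C]) (auto simp: indicator_def)
qed

text \<open>Almost every \<open>\<xi>\<close> differs from both limit ends, so it is eventually
  inside all the cells or outside all of them, and dominated convergence applies. The limit cell may
  be degenerate, which is what extends the gradient to coinciding nodes.\<close>

lemma tendsto_cell_int:
  assumes k: "cell_kernel k" and U: "U \<longlonglongrightarrow> u" and V: "V \<longlonglongrightarrow> v"
  shows "(\<lambda>n. cell_int \<mu> k (U n) (V n)) \<longlonglongrightarrow> cell_int \<mu> k u v"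
proof -
  \<comment> \<open>Convergent ends keep the cell lengths bounded, so a single bound
    \<open>C\<close> on the kernel serves all \<open>n\<close>.\<close>
  have "Bseq (\<lambda>n. V n - U n)"
    using tendsto_diff[OF V U] by (intro convergent_imp_Bseq) (auto simp: convergent_def)
  then obtain M where M: "\<And>n. \<bar>V n - U n\<bar> \<le> M"
    unfolding Bseq_def by auto
  obtain C where C: "C \<ge> 0" "\<And>p q. 0 < p \<Longrightarrow> p \<le> M \<Longrightarrow> 0 < q \<Longrightarrow> q \<le> M \<Longrightarrow> \<bar>k p q\<bar> \<le> C"
    using k unfolding cell_kernel_def by meson
  show ?thesis
    unfolding cell_int_def set_lebesgue_integral_def
  proof (rule integral_dominated_convergence)
    show "integrable \<mu> (\<lambda>_. C)" by simp
    show "(\<lambda>\<xi>. indicator {u<..<v} \<xi> *\<^sub>R k (\<xi> - u) (v - \<xi>)) \<in> borel_measurable \<mu>"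
      "(\<lambda>\<xi>. indicator {U i<..<V i} \<xi> *\<^sub>R k (\<xi> - U i) (V i - \<xi>)) \<in> borel_measurable \<mu>" for i
      using set_integrable_cell[OF k] unfolding set_integrable_def by auto
    show "AE \<xi> in \<mu>. norm (indicator {U i<..<V i} \<xi> *\<^sub>R k (\<xi> - U i) (V i - \<xi>)) \<le> C" for i
    proof (rule AE_I2)
      fix \<xi>
      show "norm (indicator {U i<..<V i} \<xi> *\<^sub>R k (\<xi> - U i) (V i - \<xi>)) \<le> C"
        using C(1) C(2)[of "\<xi> - U i" "V i - \<xi>"] M[of i] by (auto simp: indicator_def)
    qed
    show "AE \<xi> in \<mu>. (\<lambda>i. indicator {U i<..<V i} \<xi> *\<^sub>R k (\<xi> - U i) (V i - \<xi>))
        \<longlonglongrightarrow> indicator {u<..<v} \<xi> *\<^sub>R k (\<xi> - u) (v - \<xi>)"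
      using AE_neq[of u] AE_neq[of v]
    proof eventually_elim
      case (elim \<xi>)
      consider "u < \<xi>" "\<xi> < v" | "\<xi> < u" | "v < \<xi>"
        using elim by linarith
      then show ?case
      proof cases
        case 1
        have "isCont (\<lambda>(p, q). k p q) (\<xi> - u, v - \<xi>)"
          using k 1 unfolding cell_kernel_def
          by (auto simp: continuous_on_eq_continuous_at open_Times)
        from isCont_tendsto_compose[OF this tendsto_Pair[OF tendsto_diff[OF tendsto_const U]
            tendsto_diff[OF V tendsto_const]]]
        have "(\<lambda>i. k (\<xi> - U i) (V i - \<xi>)) \<longlonglongrightarrow> k (\<xi> - u) (v - \<xi>)" by simp
        moreover have "\<forall>\<^sub>F i in sequentially. k (\<xi> - U i) (V i - \<xi>)
            = indicator {U i<..<V i} \<xi> *\<^sub>R k (\<xi> - U i) (V i - \<xi>)"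
          using order_tendstoD(2)[OF U 1(1)] order_tendstoD(1)[OF V 1(2)]
          by eventually_elim auto
        ultimately show ?thesis
          using 1 by (simp add: Lim_transform_eventually)
      next
        case 2
        have "\<forall>\<^sub>F i in sequentially. indicator {U i<..<V i} \<xi> *\<^sub>R k (\<xi> - U i) (V i - \<xi>) = 0"
          using order_tendstoD(1)[OF U 2] by eventually_elim auto
        then show ?thesis using 2 by (simp add: tendsto_eventually)
      next
        case 3
        have "\<forall>\<^sub>F i in sequentially. indicator {U i<..<V i} \<xi> *\<^sub>R k (\<xi> - U i) (V i - \<xi>) = 0"
          using order_tendstoD(2)[OF V 3] by eventually_elim auto
        then show ?thesis using 3 by (simp add: tendsto_eventually)
      qed
    qed
  qed
qed

lemma continuous_on_cell_int:
  fixes f g :: "'x::metric_space \<Rightarrow> real"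
  assumes "cell_kernel k" "continuous_on S f" "continuous_on S g"
  shows "continuous_on S (\<lambda>x. cell_int \<mu> k (f x) (g x))"
  unfolding continuous_on_sequentially comp_def
proof (intro allI ballI impI, elim conjE)
  fix X x assume X: "x \<in> S" "\<forall>n. X n \<in> S" "X \<longlonglongrightarrow> x"
  show "(\<lambda>n. cell_int \<mu> k (f (X n)) (g (X n))) \<longlonglongrightarrow> cell_int \<mu> k (f x) (g x)"
    using X by (intro tendsto_cell_int[OF assms(1)] continuous_on_tendsto_compose[OF assms(2)]
      continuous_on_tendsto_compose[OF assms(3)] always_eventually)
qed

text \<open>For fixed \<open>\<xi>\<close> the integrand cut off outside the cell is Lipschitz in
  the cell ends near \<open>(u, v)\<close>, and it can fail to be differentiable there only if
  \<open>\<xi>\<close> is \<open>u\<close> or \<open>v\<close>, which has probability zero.\<close>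

lemma has_derivative_cell_int_cell_err:
  assumes r: "r \<ge> 1" and uv: "u < v"
  shows "((\<lambda>z. cell_int \<mu> (cell_err r) (fst z) (snd z)) has_derivative
    (\<lambda>d. d \<bullet> (- cell_int \<mu> (\<lambda>p q. cell_slope r q p) u v, cell_int \<mu> (cell_slope r) u v))) (at (u, v))"
proof -
  define F where "F z \<xi> = indicator {fst z<..<snd z} \<xi> *\<^sub>R cell_err r (\<xi> - fst z) (snd z - \<xi>)"
    for z :: "real \<times> real" and \<xi> :: real
  define e\<^sub>1 e\<^sub>2 :: "real \<times> real" where "e\<^sub>1 = (- 1, 0)" and "e\<^sub>2 = (0, 1)"
  \<comment> \<open>Fixed vectors \<open>e\<^sub>1\<close> and \<open>e\<^sub>2\<close> let the
    integral of \<open>g\<close> split into two scalar integrals.\<close>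
  define g where
    "g \<xi> = (indicator {u<..<v} \<xi> *\<^sub>R cell_slope r (v - \<xi>) (\<xi> - u)) *\<^sub>R e\<^sub>1
      + (indicator {u<..<v} \<xi> *\<^sub>R cell_slope r (\<xi> - u) (v - \<xi>)) *\<^sub>R e\<^sub>2" for \<xi>
  \<comment> \<open>\<open>M\<close> bounds all distances that occur for \<open>\<xi>\<close> in
    \<open>{a..b}\<close> and cell ends within distance 1 of \<open>(u, v)\<close>.\<close>
  define M where "M = \<bar>a\<bar> + \<bar>b\<bar> + \<bar>u\<bar> + \<bar>v\<bar> + 1"
  define C where "C = (r + 1) * M powr (r - 1)"
  have C: "C \<ge> 0" using r by (simp add: C_def)
  \<comment> \<open>Unlike the indicator, this form shows that the integrand is Lipschitz across the
    ends of the cell.\<close>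
  have F_max: "F z \<xi> = cell_err r (max 0 (\<xi> - fst z)) (max 0 (snd z - \<xi>))" for z \<xi>
    by (cases "fst z < \<xi>"; cases "\<xi> < snd z") (simp_all add: F_def max_def)
  have i1: "integrable \<mu> (\<lambda>\<xi>. indicator {u<..<v} \<xi> *\<^sub>R cell_slope r (\<xi> - u) (v - \<xi>))"
    and i2: "integrable \<mu> (\<lambda>\<xi>. indicator {u<..<v} \<xi> *\<^sub>R cell_slope r (v - \<xi>) (\<xi> - u))"
    using set_integrable_cell[OF cell_kernel_cell_slope[OF r]]
      set_integrable_cell[OF cell_kernel_flip[OF cell_kernel_cell_slope[OF r]]]
    by (simp_all add: set_integrable_def)
  have "((\<lambda>z. \<integral>\<xi>. F z \<xi> \<partial>\<mu>) has_derivative (\<lambda>d. d \<bullet> (\<integral>\<xi>. g \<xi> \<partial>\<mu>))) (at (u, v))"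
  proof (rule has_derivative_integral_lipschitz)
    show "integrable \<mu> (F z)" for z
      using set_integrable_cell[OF cell_kernel_cell_err[OF r]]
      by (simp add: set_integrable_def F_def[abs_def])
    show "integrable \<mu> g"
      unfolding g_def[abs_def] using i1 i2 by simp
    show "AE \<xi> in \<mu>. ((\<lambda>z. F z \<xi>) has_derivative (\<lambda>d. d \<bullet> g \<xi>)) (at (u, v))"
      using AE_neq[of u] AE_neq[of v]
    proof eventually_elim
      case (elim \<xi>)
      show ?case
      proof (cases "u < \<xi> \<and> \<xi> < v")
        case True
        let ?S = "{z. fst z < \<xi> \<and> \<xi> < snd z}"
        have "open ?S" by (intro open_Collect_conj open_Collect_less continuous_intros)
        have "((\<lambda>z. F z \<xi>) has_derivative
            (\<lambda>d. d \<bullet> (- cell_slope r (v - \<xi>) (\<xi> - u), cell_slope r (\<xi> - u) (v - \<xi>)))) (at (u, v))"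
          by (rule has_derivative_transform_within_open[OF has_derivative_cell_err \<open>open ?S\<close>])
            (use True in \<open>auto simp: F_def\<close>)
        then show ?thesis using True by (simp add: g_def e\<^sub>1_def e\<^sub>2_def)
      next
        case False
        let ?S = "{z. \<xi> < fst z \<or> snd z < \<xi>}"
        have "open ?S" by (intro open_Collect_disj open_Collect_less continuous_intros)
        have "((\<lambda>z. F z \<xi>) has_derivative (\<lambda>d. 0)) (at (u, v))"
          by (rule has_derivative_transform_within_open[OF has_derivative_const[of 0] \<open>open ?S\<close>])
            (use False elim in \<open>auto simp: F_def\<close>)
        then show ?thesis using False by (simp add: g_def)
      qed
    qed
    show "AE \<xi> in \<mu>. \<forall>z\<in>ball (u, v) 1. \<bar>F z \<xi> - F (u, v) \<xi>\<bar> \<le> (2 * C) * norm (z - (u, v))"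
      using AE_interval
    proof (eventually_elim, intro ballI)
      fix \<xi> z assume \<xi>: "\<xi> \<in> {a..b}" and z: "z \<in> ball (u, v) 1"
      have n: "\<bar>fst z - u\<bar> \<le> norm (z - (u, v))" "\<bar>snd z - v\<bar> \<le> norm (z - (u, v))"
        using norm_fst_le[of "fst z - u" "snd z - v"] norm_snd_le[of "snd z - v" "fst z - u"]
        by (cases z; simp)+
      moreover have "norm (z - (u, v)) < 1"
        using z by (simp add: dist_norm norm_minus_commute)
      ultimately have "\<bar>cell_err r (max 0 (\<xi> - fst z)) (max 0 (snd z - \<xi>))
           - cell_err r (max 0 (\<xi> - u)) (max 0 (v - \<xi>))\<bar>
         \<le> (r + 1) * M powr (r - 1) * (\<bar>max 0 (\<xi> - fst z) - max 0 (\<xi> - u)\<bar>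
              + \<bar>max 0 (snd z - \<xi>) - max 0 (v - \<xi>)\<bar>)"
        using \<xi> by (intro cell_err_lipschitz r) (auto simp: M_def)
      also have "\<dots> \<le> C * (norm (z - (u, v)) + norm (z - (u, v)))"
        unfolding C_def[symmetric] using n by (intro mult_left_mono add_mono C) auto
      finally show "\<bar>F z \<xi> - F (u, v) \<xi>\<bar> \<le> (2 * C) * norm (z - (u, v))"
        by (simp add: F_max)
    qed
  qed (auto intro: finite_measure_axioms)
  moreover have "(\<integral>\<xi>. g \<xi> \<partial>\<mu>) = (- cell_int \<mu> (\<lambda>p q. cell_slope r q p) u v, cell_int \<mu> (cell_slope r) u v)"
    unfolding g_def using i1 i2
    by (simp add: cell_int_def set_lebesgue_integral_def) (simp add: e\<^sub>1_def e\<^sub>2_def)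
  ultimately show ?thesis
    by (simp add: F_def cell_int_def set_lebesgue_integral_def)
qed

end

section \<open>Strict comparisons under full support\<close>

lemma cell_err_nonneg: "0 \<le> p \<Longrightarrow> 0 \<le> q \<Longrightarrow> 0 \<le> cell_err r p q"
  by (simp add: cell_err_def)

locale full_support_on_interval = atomless_on_interval +
  assumes support: "\<And>u v. a \<le> u \<Longrightarrow> u < v \<Longrightarrow> v \<le> b \<Longrightarrow> measure \<mu> {u<..<v} \<noteq> 0"
begin

lemma integral_strict_mono:
  fixes X Y :: "real \<Rightarrow> real"
  assumes "integrable \<mu> X" "integrable \<mu> Y" "\<And>\<xi>. X \<xi> \<le> Y \<xi>"
    and "\<And>\<xi>. u < \<xi> \<Longrightarrow> \<xi> < v \<Longrightarrow> X \<xi> < Y \<xi>" and "a \<le> u" "u < v" "v \<le> b"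
  shows "integral\<^sup>L \<mu> X < integral\<^sup>L \<mu> Y"
proof (rule integral_less_AE[OF assms(1,2)])
  show "emeasure \<mu> {u<..<v} \<noteq> 0"
    using support assms by (simp add: emeasure_eq_measure)
  show "AE \<xi> in \<mu>. \<xi> \<in> {u<..<v} \<longrightarrow> X \<xi> \<noteq> Y \<xi>"
    using assms(4) by (intro AE_I2) force
qed (use assms in \<open>auto simp: sets_eq\<close>)

text \<open>Moving the left end outward raises the slope at each old point and adds points with
  positive slope. The case \<open>u = v\<close> compares with an empty cell and yields
  positivity.\<close>

lemma cell_int_slope_strict_mono:
  assumes r: "r \<ge> 1" and "a \<le> u'" "u' < u" "u \<le> v" "v \<le> b"
  shows "cell_int \<mu> (cell_slope r) u v < cell_int \<mu> (cell_slope r) u' v"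
  unfolding cell_int_def set_lebesgue_integral_def
proof (rule integral_strict_mono[of _ _ u' v])
  fix \<xi>
  have pos: "0 < cell_slope r (\<xi> - u') (v - \<xi>)" if "u' < \<xi>" "\<xi> < v"
    using that r by (intro cell_slope_pos) auto
  have less: "cell_slope r (\<xi> - u) (v - \<xi>) < cell_slope r (\<xi> - u') (v - \<xi>)" if "u < \<xi>" "\<xi> < v"
    using that assms by (intro cell_slope_strict_mono) auto
  show "indicator {u<..<v} \<xi> *\<^sub>R cell_slope r (\<xi> - u) (v - \<xi>)
      \<le> indicator {u'<..<v} \<xi> *\<^sub>R cell_slope r (\<xi> - u') (v - \<xi>)"
    using pos less assms by (auto simp: indicator_def less_imp_le)
  show "indicator {u<..<v} \<xi> *\<^sub>R cell_slope r (\<xi> - u) (v - \<xi>)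
      < indicator {u'<..<v} \<xi> *\<^sub>R cell_slope r (\<xi> - u') (v - \<xi>)" if "u' < \<xi>" "\<xi> < v"
    using that pos less assms by (auto simp: indicator_def)
qed (use assms set_integrable_cell[OF cell_kernel_cell_slope[OF r]] in \<open>auto simp: set_integrable_def\<close>)

lemma cell_int_slope_flip_strict_mono:
  assumes r: "r \<ge> 1" and "a \<le> u" "u \<le> v" "v < v'" "v' \<le> b"
  shows "cell_int \<mu> (\<lambda>p q. cell_slope r q p) u v < cell_int \<mu> (\<lambda>p q. cell_slope r q p) u v'"
  unfolding cell_int_def set_lebesgue_integral_def
proof (rule integral_strict_mono[of _ _ u v'])
  fix \<xi>
  have pos: "0 < cell_slope r (v' - \<xi>) (\<xi> - u)" if "u < \<xi>" "\<xi> < v'"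
    using that r by (intro cell_slope_pos) auto
  have less: "cell_slope r (v - \<xi>) (\<xi> - u) < cell_slope r (v' - \<xi>) (\<xi> - u)" if "u < \<xi>" "\<xi> < v"
    using that assms by (intro cell_slope_strict_mono) auto
  show "indicator {u<..<v} \<xi> *\<^sub>R cell_slope r (v - \<xi>) (\<xi> - u)
      \<le> indicator {u<..<v'} \<xi> *\<^sub>R cell_slope r (v' - \<xi>) (\<xi> - u)"
    using pos less assms by (auto simp: indicator_def less_imp_le)
  show "indicator {u<..<v} \<xi> *\<^sub>R cell_slope r (v - \<xi>) (\<xi> - u)
      < indicator {u<..<v'} \<xi> *\<^sub>R cell_slope r (v' - \<xi>) (\<xi> - u)" if "u < \<xi>" "\<xi> < v'"
    using that pos less assms by (auto simp: indicator_def)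
qed (use assms set_integrable_cell[OF cell_kernel_flip[OF cell_kernel_cell_slope[OF r]]]
    in \<open>auto simp: set_integrable_def\<close>)

lemma cell_int_slope_eq_0_iff:
  assumes "r \<ge> 1" "a \<le> u" "u \<le> v" "v \<le> b"
  shows "cell_int \<mu> (cell_slope r) u v = 0 \<longleftrightarrow> u = v"
    and "cell_int \<mu> (\<lambda>p q. cell_slope r q p) u v = 0 \<longleftrightarrow> u = v"
  using cell_int_slope_strict_mono[of r u v v] cell_int_slope_flip_strict_mono[of r u u v] assms
  by (cases "u = v"; force)+

text \<open>After the split a point keeps its distance to one end and has a smaller one to the
  other, and \<open>cell_err\<close> increases in each distance; at \<open>w\<close> itself both new
  integrands are zero.\<close>

lemma cell_int_err_split:
  assumes r: "r \<ge> 1" and "a \<le> u" "u < w" "w < v" "v \<le> b"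
  shows "cell_int \<mu> (cell_err r) u w + cell_int \<mu> (cell_err r) w v < cell_int \<mu> (cell_err r) u v"
proof -
  define I where "I u v \<xi> = indicator {u<..<v} \<xi> *\<^sub>R cell_err r (\<xi> - u) (v - \<xi>)" for u v \<xi> :: real
  have int: "integrable \<mu> (I u v)" for u v
    using set_integrable_cell[OF cell_kernel_cell_err[OF r]]
    by (simp add: set_integrable_def I_def[abs_def])
  have less: "I u w \<xi> + I w v \<xi> < I u v \<xi>" if "u < \<xi>" "\<xi> < w" for \<xi>
    using that assms cell_err_strict_mono[of r "\<xi> - u" "w - \<xi>" "v - \<xi>"] by (simp add: I_def)
  have "I u w \<xi> + I w v \<xi> \<le> I u v \<xi>" for \<xi>
  proof -
    consider "\<xi> < w" | "\<xi> = w" | "w < \<xi>" by linarith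
    then show ?thesis
    proof cases
      case 1
      then show ?thesis using less[of \<xi>] assms by (cases "u < \<xi>") (auto simp: I_def)
    next
      case 2
      then show ?thesis using assms by (auto simp: I_def cell_err_nonneg)
    next
      case 3
      then show ?thesis
        using assms cell_err_strict_mono[of r "v - \<xi>" "\<xi> - w" "\<xi> - u"]
        by (cases "\<xi> < v") (auto simp: I_def cell_err_commute[of r _ "v - \<xi>"])
    qed
  qed
  then have "(\<integral>\<xi>. I u w \<xi> + I w v \<xi> \<partial>\<mu>) < (\<integral>\<xi>. I u v \<xi> \<partial>\<mu>)"
    using int less assms by (intro integral_strict_mono[of _ _ u w]) auto
  moreover have "cell_int \<mu> (cell_err r) u v = (\<integral>\<xi>. I u v \<xi> \<partial>\<mu>)" for u v
    by (simp add: cell_int_def set_lebesgue_integral_def I_def)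
  ultimately show ?thesis using int by simp
qed

end

section \<open>Log-concavity and translated cells\<close>

locale log_concave_density = atomless_on_interval +
  fixes f :: "real \<Rightarrow> real"
  assumes f_measurable [measurable]: "f \<in> borel_measurable borel"
    and density: "\<mu> = density lborel (\<lambda>t. ennreal (f t))"
    and f_pos: "\<And>t. a < t \<Longrightarrow> t < b \<Longrightarrow> f t > 0"
    and log_concave: "concave_on {a<..<b} (\<lambda>t. ln (f t))"
    and f_outside: "\<And>t. t \<notin> {a<..<b} \<Longrightarrow> f t = 0"
begin

lemma f_nonneg: "f t \<ge> 0"
  using f_pos[of t] f_outside[of t] by (cases "t \<in> {a<..<b}") auto

sublocale full_support_on_interval
proof unfold_locales
  fix u v assume uv: "a \<le> u" "u < v" "v \<le> b"
  show "measure \<mu> {u<..<v} \<noteq> 0"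
  proof
    assume "measure \<mu> {u<..<v} = 0"
    then have "emeasure \<mu> {u<..<v} = 0" by (simp add: emeasure_eq_measure)
    then have "(\<integral>\<^sup>+ t. ennreal (f t) * indicator {u<..<v} t \<partial>lborel) = 0"
      by (simp add: density emeasure_density)
    then have "AE t in lborel. ennreal (f t) * indicator {u<..<v} t = 0"
      by (subst (asm) nn_integral_0_iff_AE) auto
    then have "AE t in lborel. t \<notin> {u<..<v}"
    proof eventually_elim
      case (elim t)
      then show ?case using f_pos[of t] uv by (auto simp: indicator_def split: if_splits)
    qed
    then have "emeasure lborel {u<..<v} = 0"
      by (subst (asm) AE_iff_null) (auto simp: null_sets_def greaterThanLessThan_eq Int_def)
    then show False using uv by simp
  qed
qed

lemma cell_int_density:
  assumes "cell_kernel k"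
  shows "cell_int \<mu> k u v = (\<integral>\<xi>. f \<xi> * (indicator {u<..<v} \<xi> * k (\<xi> - u) (v - \<xi>)) \<partial>lborel)"
    and "integrable lborel (\<lambda>\<xi>. f \<xi> * (indicator {u<..<v} \<xi> * k (\<xi> - u) (v - \<xi>)))"
proof -
  have int: "integrable (density lborel (\<lambda>t. ennreal (f t))) (\<lambda>\<xi>. indicator {u<..<v} \<xi> * k (\<xi> - u) (v - \<xi>))"
    using set_integrable_cell[OF assms, of u v] unfolding set_integrable_def density by simp
  have m: "(\<lambda>\<xi>. indicator {u<..<v} \<xi> * k (\<xi> - u) (v - \<xi>)) \<in> borel_measurable lborel"
    using borel_measurable_integrable[OF int] by simp
  show "cell_int \<mu> k u v = (\<integral>\<xi>. f \<xi> * (indicator {u<..<v} \<xi> * k (\<xi> - u) (v - \<xi>)) \<partial>lborel)"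
    unfolding cell_int_def set_lebesgue_integral_def density
    using m f_nonneg by (subst integral_density) auto
  show "integrable lborel (\<lambda>\<xi>. f \<xi> * (indicator {u<..<v} \<xi> * k (\<xi> - u) (v - \<xi>)))"
    using int m f_nonneg by (subst (asm) integrable_density) auto
qed

text \<open>The kernel sees only distances to the cell ends, so translating the variable moves the
  whole shift into the density.\<close>

lemma cell_int_shift:
  assumes k: "cell_kernel k"
  shows "cell_int \<mu> k (u + s) (v + s)
      = (\<integral>\<xi>. f (\<xi> + s) * (indicator {u<..<v} \<xi> * k (\<xi> - u) (v - \<xi>)) \<partial>lborel)" (is ?eq)
    and "integrable lborel (\<lambda>\<xi>. f (\<xi> + s) * (indicator {u<..<v} \<xi> * k (\<xi> - u) (v - \<xi>)))" (is ?int)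
proof -
  \<comment> \<open>The factor \<open>1\<close> matches the affine substitution
    \<open>s + 1 * \<xi>\<close>.\<close>
  have *: "f (s + 1 * \<xi>) * (indicator {u + s<..<v + s} (s + 1 * \<xi>) * k (s + 1 * \<xi> - (u + s)) (v + s - (s + 1 * \<xi>)))
      = f (\<xi> + s) * (indicator {u<..<v} \<xi> * k (\<xi> - u) (v - \<xi>))" for \<xi>
    by (simp add: indicator_def add.commute)
  show ?eq
    unfolding cell_int_density(1)[OF k]
    by (subst lborel_integral_real_affine[of 1 _ s]) (simp_all only: *, simp_all)
  show ?int
    using lborel_integrable_real_affine[OF cell_int_density(2)[OF k, of "u + s" "v + s"], of 1 s]
    by (simp only: *)
qed

text \<open>Both \<open>z + s\<close> and \<open>c\<close> lie between \<open>z\<close> and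
  \<open>c + s\<close>, with complementary weights \<open>l\<close> and \<open>1 - l\<close> on
  \<open>c + s\<close>; adding the two concavity inequalities cancels the weights.\<close>

lemma log_concave_shift:
  assumes "a < z" "z \<le> c" "0 \<le> s" "c + s < b"
  shows "f (c + s) * f z \<le> f (z + s) * f c"
proof (cases "c + s = z")
  case True
  then have "c = z" "s = 0" using assms by auto
  then show ?thesis by simp
next
  case False
  define l where "l = s / (c + s - z)"
  have l: "0 \<le> l" "l \<le> 1" using assms False by (auto simp: l_def divide_simps)
  have "l * (c + s - z) = s" using False by (simp add: l_def)
  then have zs: "z + s = (1 - l) *\<^sub>R z + l *\<^sub>R (c + s)"
    and c: "c = (1 - (1 - l)) *\<^sub>R z + (1 - l) *\<^sub>R (c + s)"
    by (simp_all add: algebra_simps)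
  have "(1 - l) * ln (f z) + l * ln (f (c + s)) \<le> ln (f (z + s))"
    using concave_onD[OF log_concave l, of z "c + s"] assms unfolding zs[symmetric] by simp
  moreover have "(1 - (1 - l)) * ln (f z) + (1 - l) * ln (f (c + s)) \<le> ln (f c)"
    using concave_onD[OF log_concave, of "1 - l" z "c + s"] l assms unfolding c[symmetric] by simp
  ultimately have "ln (f z) + ln (f (c + s)) \<le> ln (f (z + s)) + ln (f c)"
    by (simp add: algebra_simps)
  moreover have "f z > 0" "f (c + s) > 0" "f (z + s) > 0" "f c > 0"
    using assms by (auto intro!: f_pos)
  ultimately have "ln (f (c + s) * f z) \<le> ln (f (z + s) * f c)"
    by (simp add: ln_mult_pos)
  then show ?thesis
    using \<open>f z > 0\<close> \<open>f (c + s) > 0\<close> \<open>f (z + s) > 0\<close> \<open>f c > 0\<close> by simp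
qed

text \<open>All points of the cell lie to the left of the pivot \<open>v\<close>, so their density
  ratios under the shift are at least that of \<open>v\<close>. Cross-multiplication avoids
  dividing.\<close>

lemma cell_int_shift_ge:
  assumes k: "cell_kernel k" "\<And>p q. 0 < p \<Longrightarrow> 0 < q \<Longrightarrow> 0 \<le> k p q"
    and "a \<le> u" "u < v" "0 \<le> s" "v + s < b"
  shows "f (v + s) * cell_int \<mu> k u v \<le> f v * cell_int \<mu> k (u + s) (v + s)"
  unfolding cell_int_density(1)[OF k(1), of u v] cell_int_shift(1)[OF k(1)] integral_mult_right_zero[symmetric]
proof (rule integral_mono)
  fix \<xi>
  have "f (v + s) * f \<xi> * k (\<xi> - u) (v - \<xi>) \<le> f v * f (\<xi> + s) * k (\<xi> - u) (v - \<xi>)"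
    if "u < \<xi>" "\<xi> < v"
    using that k(2)[of "\<xi> - u" "v - \<xi>"] log_concave_shift[of \<xi> v s] assms
    by (intro mult_right_mono) (auto simp: mult.commute)
  then show "f (v + s) * (f \<xi> * (indicator {u<..<v} \<xi> * k (\<xi> - u) (v - \<xi>)))
      \<le> f v * (f (\<xi> + s) * (indicator {u<..<v} \<xi> * k (\<xi> - u) (v - \<xi>)))"
    by (auto simp: indicator_def mult.assoc)
qed (use cell_int_density(2)[OF k(1)] cell_int_shift(2)[OF k(1)] in auto)

text \<open>The mirror case: the pivot is the left end \<open>u\<close>, and points to its right
  have smaller density ratios.\<close>

lemma cell_int_shift_le:
  assumes k: "cell_kernel k" "\<And>p q. 0 < p \<Longrightarrow> 0 < q \<Longrightarrow> 0 \<le> k p q"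
    and "a < u" "u < v" "0 \<le> s"
  shows "f u * cell_int \<mu> k (u + s) (v + s) \<le> f (u + s) * cell_int \<mu> k u v"
  unfolding cell_int_density(1)[OF k(1), of u v] cell_int_shift(1)[OF k(1)] integral_mult_right_zero[symmetric]
proof (rule integral_mono)
  fix \<xi>
  have "f u * f (\<xi> + s) * k (\<xi> - u) (v - \<xi>) \<le> f (u + s) * f \<xi> * k (\<xi> - u) (v - \<xi>)"
    if "u < \<xi>" "\<xi> < v"
  proof (rule mult_right_mono)
    show "f u * f (\<xi> + s) \<le> f (u + s) * f \<xi>"
      \<comment> \<open>A point shifted to \<open>b\<close> or beyond has density zero, which makes
        the left side zero.\<close>
      using log_concave_shift[of u \<xi> s] f_outside[of "\<xi> + s"] f_nonneg that assms
      by (cases "\<xi> + s < b") (auto simp: mult.commute)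
    show "0 \<le> k (\<xi> - u) (v - \<xi>)" using that k(2) by simp
  qed
  then show "f u * (f (\<xi> + s) * (indicator {u<..<v} \<xi> * k (\<xi> - u) (v - \<xi>)))
      \<le> f (u + s) * (f \<xi> * (indicator {u<..<v} \<xi> * k (\<xi> - u) (v - \<xi>)))"
    by (auto simp: indicator_def mult.assoc)
qed (use cell_int_density(2)[OF k(1)] cell_int_shift(2)[OF k(1)] in auto)

section \<open>The shooting argument\<close>

text \<open>One step of the shooting. Shifting by \<open>s\<close> makes the middle nodes coincide,
  and both cells pick up the same factor \<open>f y\<^sub>1 / f x\<^sub>1\<close>. If the right gap
  did not grow, the strict growth of the left gap would break the balance.\<close>

lemma balanced_gap_less:
  assumes r: "r \<ge> 1"
    and x: "a \<le> x\<^sub>0" "x\<^sub>0 < x\<^sub>1" "x\<^sub>1 < x\<^sub>2" "x\<^sub>2 \<le> b"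
    and y: "a \<le> y\<^sub>0" "y\<^sub>0 < y\<^sub>1" "y\<^sub>1 < y\<^sub>2" "y\<^sub>2 \<le> b"
    and bal_x: "cell_int \<mu> (cell_slope r) x\<^sub>0 x\<^sub>1 = cell_int \<mu> (\<lambda>p q. cell_slope r q p) x\<^sub>1 x\<^sub>2"
    and bal_y: "cell_int \<mu> (cell_slope r) y\<^sub>0 y\<^sub>1 = cell_int \<mu> (\<lambda>p q. cell_slope r q p) y\<^sub>1 y\<^sub>2"
    and less: "x\<^sub>1 < y\<^sub>1" "x\<^sub>1 - x\<^sub>0 < y\<^sub>1 - y\<^sub>0"
  shows "x\<^sub>2 - x\<^sub>1 < y\<^sub>2 - y\<^sub>1"
proof (rule ccontr)
  let ?A = "cell_int \<mu> (cell_slope r)" and ?B = "cell_int \<mu> (\<lambda>p q. cell_slope r q p)"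
  assume "\<not> x\<^sub>2 - x\<^sub>1 < y\<^sub>2 - y\<^sub>1"
  then have g: "x\<^sub>1 + (y\<^sub>2 - y\<^sub>1) \<le> x\<^sub>2" by simp
  define s where "s = y\<^sub>1 - x\<^sub>1"
  have s: "s > 0" "x\<^sub>1 + s = y\<^sub>1" "x\<^sub>1 + (y\<^sub>2 - y\<^sub>1) + s = y\<^sub>2" using less by (auto simp: s_def)
  have k: "cell_kernel (cell_slope r)" "cell_kernel (\<lambda>p q. cell_slope r q p)"
    using cell_kernel_cell_slope[OF r] cell_kernel_flip by auto
  have nn: "0 \<le> cell_slope r p q" if "0 < p" "0 < q" for p q
    using cell_slope_pos[OF r that] by simp
  have pos: "f x\<^sub>1 > 0" "f y\<^sub>1 > 0" using x y by (auto intro!: f_pos)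
  have "f y\<^sub>1 * ?A x\<^sub>0 x\<^sub>1 \<le> f x\<^sub>1 * ?A (x\<^sub>0 + s) y\<^sub>1"
    using cell_int_shift_ge[OF k(1) nn, of x\<^sub>0 x\<^sub>1 s] x y s by simp
  \<comment> \<open>The larger left gap means \<open>y\<^sub>0 < x\<^sub>0 + s\<close>; this is the
    strict link of the chain.\<close>
  also have "\<dots> < f x\<^sub>1 * ?A y\<^sub>0 y\<^sub>1"
    using pos less x y by (intro mult_strict_left_mono cell_int_slope_strict_mono r) (auto simp: s_def)
  also have "\<dots> = f x\<^sub>1 * ?B y\<^sub>1 y\<^sub>2" by (simp add: bal_y)
  also have "\<dots> \<le> f y\<^sub>1 * ?B x\<^sub>1 (x\<^sub>1 + (y\<^sub>2 - y\<^sub>1))"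
    using cell_int_shift_le[OF k(2) nn, of x\<^sub>1 "x\<^sub>1 + (y\<^sub>2 - y\<^sub>1)" s] x y s by simp
  also have "\<dots> \<le> f y\<^sub>1 * ?B x\<^sub>1 x\<^sub>2"
    using cell_int_slope_flip_strict_mono[OF r, of x\<^sub>1 "x\<^sub>1 + (y\<^sub>2 - y\<^sub>1)" x\<^sub>2] g x y pos
    by (cases "x\<^sub>1 + (y\<^sub>2 - y\<^sub>1) = x\<^sub>2") auto
  finally show False by (simp add: bal_x)
qed

text \<open>Interior zeros of the gradient as plain sequences that include both end nodes, so that
  induction can run along the indices; values outside \<open>{1..N}\<close> are
  unconstrained.\<close>

definition balanced_grid :: "real \<Rightarrow> nat \<Rightarrow> (nat \<Rightarrow> real) \<Rightarrow> bool" where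
  "balanced_grid r N X \<longleftrightarrow> X 1 = a \<and> X N = b \<and> (\<forall>i\<in>{1..<N}. X i < X (i + 1)) \<and>
     (\<forall>i\<in>{2..<N}. cell_int \<mu> (cell_slope r) (X (i - 1)) (X i)
        = cell_int \<mu> (\<lambda>p q. cell_slope r q p) (X i) (X (i + 1)))"

lemma balanced_grid_bounds:
  assumes X: "balanced_grid r N X" and i: "i \<in> {1..N}"
  shows "a \<le> X i" "X i \<le> b"
proof -
  have mono: "X j \<le> X k" if "j \<le> k" "1 \<le> j" "k \<le> N" for j k
    using that(1)
  proof (rule dec_induct)
    fix n assume "j \<le> n" "n < k" "X j \<le> X n"
    then show "X j \<le> X (Suc n)"
      using X that unfolding balanced_grid_def by (force dest: bspec[of _ _ n])
  qed simp
  show "a \<le> X i" "X i \<le> b"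
    using mono[of 1 i] mono[of i N] i X unfolding balanced_grid_def by auto
qed

text \<open>A larger second node of \<open>Y\<close> would make every gap of \<open>Y\<close> larger
  and push its last node beyond \<open>b\<close>.\<close>

lemma balanced_grid_second_le:
  assumes r: "r \<ge> 1" and N: "N \<ge> 3" and X: "balanced_grid r N X" and Y: "balanced_grid r N Y"
  shows "Y 2 \<le> X 2"
proof (rule ccontr)
  assume "\<not> Y 2 \<le> X 2"
  \<comment> \<open>The order of the nodes is carried along because \<open>balanced_gap_less\<close>
    needs a shift to the right.\<close>
  have "i < N \<longrightarrow> X (i + 1) - X i < Y (i + 1) - Y i \<and> X (i + 1) < Y (i + 1)" if "1 \<le> i" for i
    using that
  proof (induction i rule: dec_induct)
    case base
    then show ?case using \<open>\<not> Y 2 \<le> X 2\<close> X Y by (simp add: balanced_grid_def numeral_2_eq_2)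
  next
    case (step i)
    show ?case
    proof
      assume i: "Suc i < N"
      then have IH: "X (i + 1) - X i < Y (i + 1) - Y i" "X (i + 1) < Y (i + 1)" using step by auto
      have "X (i + 2) - X (i + 1) < Y (i + 2) - Y (i + 1)"
      proof (rule balanced_gap_less[OF r])
        show "cell_int \<mu> (cell_slope r) (X i) (X (i + 1))
            = cell_int \<mu> (\<lambda>p q. cell_slope r q p) (X (i + 1)) (X (i + 2))"
          "cell_int \<mu> (cell_slope r) (Y i) (Y (i + 1))
            = cell_int \<mu> (\<lambda>p q. cell_slope r q p) (Y (i + 1)) (Y (i + 2))"
          using X Y i step.hyps unfolding balanced_grid_def
          by (auto dest!: bspec[of "{2..<N}" _ "i + 1"])
        show "X i < X (i + 1)" "X (i + 1) < X (i + 2)" "Y i < Y (i + 1)" "Y (i + 1) < Y (i + 2)"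
          using X Y i step.hyps unfolding balanced_grid_def
          by (auto dest!: bspec[of "{1..<N}" _ i] bspec[of "{1..<N}" _ "i + 1"])
        show "a \<le> X i" "X (i + 2) \<le> b" "a \<le> Y i" "Y (i + 2) \<le> b"
          using balanced_grid_bounds[OF X] balanced_grid_bounds[OF Y] i step.hyps by auto
      qed (use IH in auto)
      then show "X (Suc i + 1) - X (Suc i) < Y (Suc i + 1) - Y (Suc i) \<and> X (Suc i + 1) < Y (Suc i + 1)"
        using IH by simp
    qed
  qed
  from this[of "N - 1"] N have "X N < Y N" by fastforce
  then show False using X Y by (simp add: balanced_grid_def)
qed

text \<open>The second nodes agree by symmetry. From there balance determines each next node, since
  the right-hand cell integral is strictly increasing in its right end.\<close>

lemma balanced_grid_unique:
  assumes r: "r \<ge> 1" and N: "N \<ge> 3" and X: "balanced_grid r N X" and Y: "balanced_grid r N Y"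
    and i: "i \<in> {1..N}"
  shows "X i = Y i"
proof -
  have base: "X 1 = Y 1" "X 2 = Y 2"
    using balanced_grid_second_le[OF r N] X Y by (auto simp: balanced_grid_def intro: antisym)
  have "i < N \<longrightarrow> X i = Y i \<and> X (i + 1) = Y (i + 1)" if "1 \<le> i" for i
    using that
  proof (induction i rule: dec_induct)
    case base
    then show ?case using \<open>X 1 = Y 1\<close> \<open>X 2 = Y 2\<close> by (simp add: numeral_2_eq_2)
  next
    case (step i)
    show ?case
    proof
      assume i: "Suc i < N"
      let ?B = "cell_int \<mu> (\<lambda>p q. cell_slope r q p)"
      have IH: "X i = Y i" "X (i + 1) = Y (i + 1)" using step i by auto
      have "?B (X (i + 1)) (X (i + 2)) = ?B (X (i + 1)) (Y (i + 2))"
        using X Y i step.hyps IH unfolding balanced_grid_def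
        by (auto dest!: bspec[of "{2..<N}" _ "i + 1"])
      moreover have "X (i + 1) < X (i + 2)" "Y (i + 1) < Y (i + 2)"
        using X Y i step.hyps unfolding balanced_grid_def
        by (auto dest!: bspec[of "{1..<N}" _ "i + 1"])
      moreover have "a \<le> X (i + 1)" "X (i + 2) \<le> b" "Y (i + 2) \<le> b"
        using balanced_grid_bounds[OF X] balanced_grid_bounds[OF Y] i step.hyps by auto
      ultimately have "X (i + 2) = Y (i + 2)"
        using cell_int_slope_flip_strict_mono[OF r, of "X (i + 1)" "X (i + 2)" "Y (i + 2)"]
          cell_int_slope_flip_strict_mono[OF r, of "X (i + 1)" "Y (i + 2)" "X (i + 2)"] IH
        by (cases "X (i + 2)" "Y (i + 2)" rule: linorder_cases) auto
      then show "X (Suc i) = Y (Suc i) \<and> X (Suc i + 1) = Y (Suc i + 1)"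
        using IH by simp
    qed
  qed
  from this[of i] show ?thesis
    using i X Y by (cases "i = N") (auto simp: balanced_grid_def)
qed

end

text \<open>
  Coincidences in a monotone chain are all or nothing as soon as every point that coincides with
  one neighbour coincides with both.
\<close>

lemma strict_chain_if_no_partial_collision:
  fixes X :: "nat \<Rightarrow> real"
  assumes mono: "\<forall>i\<in>{1..<N}. X i \<le> X (i + 1)" and ends: "X 1 < X N" and N: "N \<ge> 1"
    and eq: "\<forall>i\<in>{2..<N}. X (i - 1) = X i \<longleftrightarrow> X i = X (i + 1)"
  shows "\<forall>i\<in>{1..<N}. X i < X (i + 1)"
proof -
  have all: "i < N \<longrightarrow> (X i = X (i + 1) \<longleftrightarrow> X 1 = X 2)" if "1 \<le> i" for i
    using that
  proof (induction i rule: dec_induct)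
    case (step i)
    then show ?case using eq by (auto dest!: bspec[of "{2..<N}" _ "Suc i"])
  qed (simp add: numeral_2_eq_2)
  have "X 1 \<noteq> X 2"
  proof
    assume "X 1 = X 2"
    have "i \<le> N \<longrightarrow> X i = X 1" if "1 \<le> i" for i
      using that
    proof (induction i rule: dec_induct)
      case (step i)
      then show ?case using all[of i] \<open>X 1 = X 2\<close> by auto
    qed simp
    from this[of N] show False using ends N by simp
  qed
  show ?thesis
  proof
    fix i assume "i \<in> {1..<N}"
    then show "X i < X (i + 1)"
      using all[of i] bspec[OF mono, of i] \<open>X 1 \<noteq> X 2\<close> by (simp add: less_le)
  qed
qed

section \<open>Grids and the gradient of the error\<close>

locale quantization_grid = atomless_on_interval \<mu> a b for \<mu> :: "real measure" and a b :: real +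
  fixes r :: real and N :: nat and e :: "nat \<Rightarrow> 'n::finite"
  assumes r: "r \<ge> 1" and N: "N \<ge> 3" and e: "bij_betw e {2..N-1} UNIV"
begin

abbreviation "grid \<equiv> node a b N e"
abbreviation "L \<equiv> dual_quant_error r a b N e \<mu>"
abbreviation "S \<equiv> ordered_simplex a b N e"
abbreviation "T \<equiv> closed_ordered_simplex a b N e"

lemma grid_simps [simp]: "grid x 1 = a" "grid x (Suc 0) = a" "grid x N = b"
  using N by (auto simp: node_def)

lemma grid_inner: "i \<in> {2..N-1} \<Longrightarrow> grid x i = x $ e i"
  using N by (auto simp: node_def)

lemma closed_simplex_iff: "x \<in> T \<longleftrightarrow> (\<forall>i\<in>{1..<N}. grid x i \<le> grid x (i + 1))"
proof
  assume x: "x \<in> T"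
  show "\<forall>i\<in>{1..<N}. grid x i \<le> grid x (i + 1)"
  proof
    fix i assume "i \<in> {1..<N}"
    then show "grid x i \<le> grid x (i + 1)"
      using x N unfolding closed_ordered_simplex_def
      by (auto simp: node_def intro: mono_onD)
  qed
next
  assume *: "\<forall>i\<in>{1..<N}. grid x i \<le> grid x (i + 1)"
  have mono: "grid x i \<le> grid x j" if "1 \<le> i" "i \<le> j" "j \<le> N" for i j
    using lift_Suc_mono_le_ivl[of "{1..<N}" "grid x" i j] that * by auto
  have "mono_on {2..N-1} (\<lambda>i. x $ e i)"
    using mono by (intro mono_onI) (force simp: grid_inner[symmetric])
  then show "x \<in> T"
    using mono[of 1] mono[of _ N] unfolding closed_ordered_simplex_def
    by (force simp: grid_inner[symmetric])
qed

lemma open_simplex_iff: "x \<in> S \<longleftrightarrow> (\<forall>i\<in>{1..<N}. grid x i < grid x (i + 1))"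
proof
  assume x: "x \<in> S"
  show "\<forall>i\<in>{1..<N}. grid x i < grid x (i + 1)"
  proof
    fix i assume "i \<in> {1..<N}"
    then show "grid x i < grid x (i + 1)"
      using x N unfolding ordered_simplex_def
      by (auto simp: node_def intro: strict_mono_onD)
  qed
next
  assume *: "\<forall>i\<in>{1..<N}. grid x i < grid x (i + 1)"
  have mono: "grid x i < grid x j" if "1 \<le> i" "i < j" "j \<le> N" for i j
    using lift_Suc_mono_less_ivl[of "{1..<N}" "grid x" i j] that * by auto
  have "strict_mono_on {2..N-1} (\<lambda>i. x $ e i)"
    using mono by (intro strict_mono_onI) (force simp: grid_inner[symmetric])
  then show "x \<in> S"
    using mono[of 1] mono[of _ N] unfolding ordered_simplex_def
    by (force simp: grid_inner[symmetric])
qed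

lemma grid_bounds:
  assumes "x \<in> T" "i \<in> {1..N}"
  shows "a \<le> grid x i" "grid x i \<le> b"
proof -
  have "i \<in> {2..N-1} \<or> i = 1 \<or> i = N" using assms(2) by auto
  then show "a \<le> grid x i" "grid x i \<le> b"
    using assms(1) ab by (auto simp: grid_inner closed_ordered_simplex_def)
qed

text \<open>Each node is affine in \<open>x\<close>; its linear part is again a node map, with both
  fixed ends replaced by 0.\<close>

lemma has_derivative_grid: "((\<lambda>x. grid x i) has_derivative (\<lambda>d. node 0 0 N e d i)) (at x)"
  unfolding node_def
  by (cases "i = 1"; cases "i = N") (auto intro!: bounded_linear.has_derivative[OF bounded_linear_vec_nth] has_derivative_ident)

lemma continuous_on_grid: "continuous_on X (\<lambda>x. grid x i)"
  using has_derivative_grid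
  by (meson continuous_at_imp_continuous_on has_derivative_continuous)

lemma open_simplex: "open S"
proof -
  have "S = (\<Inter>i\<in>{1..<N}. {x. grid x i < grid x (i + 1)})"
    using open_simplex_iff by auto
  then show ?thesis
    by (auto intro!: open_INT open_Collect_less continuous_on_grid)
qed

lemma compact_closed_simplex: "compact T"
proof -
  have "closed T"
    using closure_ordered_simplex[OF ab N e] by (metis closed_closure)
  moreover have "T \<subseteq> cbox (\<chi> k. a) (\<chi> k. b)"
  proof
    fix x assume x: "x \<in> T"
    have "a \<le> x $ k \<and> x $ k \<le> b" for k
    proof -
      have "k \<in> e ` {2..N-1}" using e by (simp add: bij_betw_def)
      then show ?thesis using x unfolding closed_ordered_simplex_def by auto
    qed
    then show "x \<in> cbox (\<chi> k. a) (\<chi> k. b)" by (simp add: mem_box_cart)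
  qed
  ultimately show ?thesis
    using compact_cbox compact_eq_bounded_closed bounded_subset bounded_cbox by metis
qed

lemma error_eq_sum_cells:
  "L x = (\<Sum>i = 1..N-1. cell_int \<mu> (cell_err r) (grid x i) (grid x (i + 1)))"
proof -
  have "(LINT \<xi>:{u<..<v}|\<mu>. (\<xi> - u) powr r * ((v - \<xi>) / (v - u)) + (v - \<xi>) powr r * ((\<xi> - u) / (v - u)))
      = cell_int \<mu> (cell_err r) u v" for u v
    unfolding cell_int_def set_lebesgue_integral_def cell_err_def
    by (intro Bochner_Integration.integral_cong) (auto simp: add_divide_distrib)
  then show ?thesis by (simp add: dual_quant_error_def Let_def)
qed

lemma continuous_on_error: "continuous_on X L"
  unfolding error_eq_sum_cells[abs_def]
  by (intro continuous_on_sum continuous_on_cell_int cell_kernel_cell_err r continuous_on_grid)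

text \<open>The inverse of \<open>e\<close> recovers the node number of a coordinate. The formula
  makes sense on the whole space, so it serves as the extension too.\<close>

definition grad :: "real ^ 'n \<Rightarrow> real ^ 'n" where
  "grad x = (\<chi> k. let i = the_inv_into {2..N-1} e k in
     cell_int \<mu> (cell_slope r) (grid x (i - 1)) (grid x i)
     - cell_int \<mu> (\<lambda>p q. cell_slope r q p) (grid x i) (grid x (i + 1)))"

lemma grad_nth:
  assumes "i \<in> {2..N-1}"
  shows "grad x $ e i = cell_int \<mu> (cell_slope r) (grid x (i - 1)) (grid x i)
     - cell_int \<mu> (\<lambda>p q. cell_slope r q p) (grid x i) (grid x (i + 1))"
proof -
  have "the_inv_into {2..N-1} e (e i) = i"
    using e assms by (simp add: bij_betw_def the_inv_into_f_f)
  then show ?thesis by (simp add: grad_def Let_def)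
qed

lemma continuous_on_grad: "continuous_on X grad"
  unfolding grad_def[abs_def] Let_def
  by (intro continuous_on_vec_lambda continuous_on_diff continuous_on_cell_int continuous_on_grid
    cell_kernel_cell_slope[OF r] cell_kernel_flip[OF cell_kernel_cell_slope[OF r]])

text \<open>Each inner node is the right end of one cell and the left end of the next; regrouping
  the sum over cells by nodes collects these two contributions.\<close>

lemma gderiv_error:
  assumes x: "x \<in> S"
  shows "GDERIV L x :> grad x"
proof -
  let ?n = "node 0 0 N e"
  define A B where "A i = cell_int \<mu> (cell_slope r) (grid x i) (grid x (i + 1))"
    and "B i = cell_int \<mu> (\<lambda>p q. cell_slope r q p) (grid x i) (grid x (i + 1))" for i
  have "(L has_derivative (\<lambda>d. \<Sum>i = 1..N-1. (?n d i, ?n d (i + 1)) \<bullet> (- B i, A i))) (at x)"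
    unfolding error_eq_sum_cells[abs_def]
  proof (rule has_derivative_sum)
    fix i assume "i \<in> {1..N-1}"
    then have "grid x i < grid x (i + 1)" using x by (auto simp: open_simplex_iff)
    from has_derivative_cell_int_cell_err[OF r this]
    show "((\<lambda>x. cell_int \<mu> (cell_err r) (grid x i) (grid x (i + 1))) has_derivative
        (\<lambda>d. (?n d i, ?n d (i + 1)) \<bullet> (- B i, A i))) (at x)"
      using has_derivative_compose[OF has_derivative_Pair[OF has_derivative_grid has_derivative_grid]]
      unfolding A_def B_def by fastforce
  qed
  moreover have "(\<Sum>i = 1..N-1. (?n d i, ?n d (i + 1)) \<bullet> (- B i, A i)) = d \<bullet> grad x" for d
  proof -
    \<comment> \<open>Directions vanish at the end nodes, which removes the first \<open>B\<close>
      term and the last \<open>A\<close> term.\<close>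
    have ends: "?n d (Suc 0) = 0" "?n d N = 0" by (auto simp: node_def)
    obtain M where M: "N = Suc M" "M \<ge> 2" using N by (cases N) auto
    have 1: "(\<Sum>i = 1..M. ?n d i * B i) = (\<Sum>i = 2..M. ?n d i * B i)"
      using M ends by (simp add: sum.atLeast_Suc_atMost numeral_2_eq_2)
    have "(\<Sum>i = 1..M. ?n d (i + 1) * A i) = (\<Sum>i = Suc 1..Suc M. ?n d i * A (i - 1))"
      unfolding sum.shift_bounds_cl_Suc_ivl by simp
    also have "\<dots> = (\<Sum>i = 2..M. ?n d i * A (i - 1))"
      using M ends by (simp add: numeral_2_eq_2)
    finally have 2: "(\<Sum>i = 1..M. ?n d (i + 1) * A i) = (\<Sum>i = 2..M. ?n d i * A (i - 1))" .
    have "(\<Sum>i = 1..N-1. (?n d i, ?n d (i + 1)) \<bullet> (- B i, A i))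
        = (\<Sum>i = 1..M. ?n d (i + 1) * A i) - (\<Sum>i = 1..M. ?n d i * B i)"
      using M by (simp add: sum_subtractf inner_prod_def algebra_simps)
    also have "\<dots> = (\<Sum>i\<in>{2..N-1}. d $ e i * grad x $ e i)"
      unfolding 1 2 sum_subtractf[symmetric]
    proof (rule sum.cong)
      fix i assume i: "i \<in> {2..N-1}"
      then have "?n d i = d $ e i" "i - 1 + 1 = i" using N by (auto simp: node_def)
      then show "?n d i * A (i - 1) - ?n d i * B i = d $ e i * grad x $ e i"
        by (simp only: grad_nth[OF i] A_def B_def right_diff_distrib)
    qed (use M in simp)
    also have "\<dots> = (\<Sum>k\<in>UNIV. d $ k * grad x $ k)"
      using e by (rule sum.reindex_bij_betw)
    finally show ?thesis by (simp add: inner_vec_def)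
  qed
  ultimately show ?thesis by (simp add: gderiv_def)
qed

text \<open>Gradients are unique on \<open>S\<close>, and continuous maps agreeing on
  \<open>S\<close> agree on its closure \<open>T\<close>.\<close>

lemma gradient_extension_eq:
  assumes G: "continuous_gradient_extension L S T G" and x: "x \<in> T"
  shows "G x = grad x"
proof -
  have "G y - grad y = 0" if "y \<in> S" for y
  proof -
    have "GDERIV L y :> G y" using G that by (auto simp: continuous_gradient_extension_def)
    then have "(\<lambda>d. d \<bullet> G y) = (\<lambda>d. d \<bullet> grad y)"
      using gderiv_error[OF that] has_derivative_unique unfolding gderiv_def by blast
    then show ?thesis by (metis right_minus_eq vector_eq_ldot)
  qed
  moreover have "continuous_on (closure S) (\<lambda>y. G y - grad y)"
    using G continuous_on_grad closure_ordered_simplex[OF ab N e]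
    by (auto simp: continuous_gradient_extension_def intro!: continuous_on_diff)
  ultimately have "G x - grad x = 0"
    using closure_ordered_simplex[OF ab N e] x
      continuous_constant_on_closure[of S "\<lambda>y. G y - grad y" 0 x] by simp
  then show ?thesis by simp
qed

end

section \<open>Zeros of the gradient for a log-concave density\<close>

locale log_concave_grid =
  quantization_grid \<mu> a b r N e + log_concave_density \<mu> a b f
  for \<mu> :: "real measure" and a b r :: real and N :: nat and e :: "nat \<Rightarrow> 'n::finite"
    and f :: "real \<Rightarrow> real"
begin

text \<open>At a zero the two cell integrals at a node are equal, and each vanishes only on a
  degenerate cell. So a node meets both neighbours or neither, and \<open>a < b\<close> excludes a
  total collapse.\<close>

lemma grad_zero_imp_balanced:
  assumes x: "x \<in> T" and 0: "grad x = 0"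
  shows "x \<in> S" "balanced_grid r N (grid x)"
proof -
  have bal: "\<forall>i\<in>{2..<N}. cell_int \<mu> (cell_slope r) (grid x (i - 1)) (grid x i)
      = cell_int \<mu> (\<lambda>p q. cell_slope r q p) (grid x i) (grid x (i + 1))"
  proof
    fix i assume "i \<in> {2..<N}"
    then show "cell_int \<mu> (cell_slope r) (grid x (i - 1)) (grid x i)
      = cell_int \<mu> (\<lambda>p q. cell_slope r q p) (grid x i) (grid x (i + 1))"
      using grad_nth[of i x] 0 by auto
  qed
  have mono: "\<forall>i\<in>{1..<N}. grid x i \<le> grid x (i + 1)"
    using x closed_simplex_iff by blast
  have strict: "\<forall>i\<in>{1..<N}. grid x i < grid x (i + 1)"
  proof (rule strict_chain_if_no_partial_collision[OF mono])
    show "\<forall>i\<in>{2..<N}. grid x (i - 1) = grid x i \<longleftrightarrow> grid x i = grid x (i + 1)"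
    proof
      fix i assume i: "i \<in> {2..<N}"
      have "a \<le> grid x (i - 1)" "grid x i \<le> b" "a \<le> grid x i" "grid x (i + 1) \<le> b"
        by (rule grid_bounds[OF x]; use i in auto)+
      moreover have "i - 1 \<in> {1..<N}" "i \<in> {1..<N}" "i - 1 + 1 = i" using i by auto
      then have "grid x (i - 1) \<le> grid x i" "grid x i \<le> grid x (i + 1)"
        using mono by metis+
      ultimately show "grid x (i - 1) = grid x i \<longleftrightarrow> grid x i = grid x (i + 1)"
        using cell_int_slope_eq_0_iff(1)[OF r, of "grid x (i - 1)" "grid x i"]
          cell_int_slope_eq_0_iff(2)[OF r, of "grid x i" "grid x (i + 1)"] bspec[OF bal i] by simp
    qed
  qed (use ab N in auto)
  then show "x \<in> S" by (simp add: open_simplex_iff)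
  show "balanced_grid r N (grid x)"
    using strict bal by (simp add: balanced_grid_def)
qed

lemma grad_zero_unique:
  assumes "x \<in> T" "grad x = 0" "y \<in> T" "grad y = 0"
  shows "x = y"
proof (rule vec_eq_iff[THEN iffD2], rule allI)
  fix k
  have "k \<in> e ` {2..N-1}" using e by (simp add: bij_betw_def)
  then obtain i where i: "i \<in> {2..N-1}" "k = e i" by blast
  have "grid x i = grid y i"
    using i assms by (intro balanced_grid_unique[OF r N] grad_zero_imp_balanced) auto
  then show "x $ k = y $ k" using i by (simp add: grid_inner)
qed

text \<open>
  A point coinciding with exactly one neighbour can be moved into the adjacent nondegenerate cell,
  and splitting that cell lowers the error.
\<close>

lemma minimizer_interior:
  assumes x: "x \<in> T" and min: "\<And>y. y \<in> T \<Longrightarrow> L x \<le> L y"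
  shows "x \<in> S"
proof -
  have mono: "\<forall>i\<in>{1..<N}. grid x i \<le> grid x (i + 1)"
    using x closed_simplex_iff by blast
  have "\<forall>i\<in>{1..<N}. grid x i < grid x (i + 1)"
  proof (rule strict_chain_if_no_partial_collision[OF mono])
    show "\<forall>i\<in>{2..<N}. grid x (i - 1) = grid x i \<longleftrightarrow> grid x i = grid x (i + 1)"
    proof (intro ballI, rule ccontr)
      fix i assume i: "i \<in> {2..<N}" and neq: "(grid x (i - 1) = grid x i) \<noteq> (grid x i = grid x (i + 1))"
      define w where "w = (grid x (i - 1) + grid x (i + 1)) / 2"
      have "i - 1 \<in> {1..<N}" "i \<in> {1..<N}" "i - 1 + 1 = i" using i by auto
      then have "grid x (i - 1) \<le> grid x i" "grid x i \<le> grid x (i + 1)"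
        using mono by metis+
      then have w: "grid x (i - 1) < w" "w < grid x (i + 1)"
        using neq by (auto simp: w_def)
      define y where "y = (\<chi> k. if k = e i then w else x $ k)"
      have y: "grid y j = (if j = i then w else grid x j)" if "j \<in> {1..N}" for j
      proof (cases "j \<in> {2..N-1}")
        case True
        then have "e j = e i \<longleftrightarrow> j = i"
          using e i by (auto simp: bij_betw_def inj_on_def)
        then show ?thesis using True by (simp add: grid_inner y_def)
      next
        case False
        then have "j = 1 \<or> j = N" using that by auto
        then show ?thesis using i by auto
      qed
      have "y \<in> T"
        unfolding closed_simplex_iff
      proof
        fix j assume j: "j \<in> {1..<N}"
        have "j = i \<or> j + 1 = i \<or> (j \<noteq> i \<and> j + 1 \<noteq> i)" by blast
        then show "grid y j \<le> grid y (j + 1)"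
          using mono[rule_format, OF j] w j y[of j] y[of "j + 1"] by auto
      qed
      let ?D = "cell_int \<mu> (cell_err r)"
      let ?g = "\<lambda>x i. ?D (grid x i) (grid x (i + 1))"
      have "L y - L x = (\<Sum>j = 1..N-1. ?g y j - ?g x j)"
        by (simp add: error_eq_sum_cells sum_subtractf)
      also have "\<dots> = (\<Sum>j\<in>{i - 1, i}. ?g y j - ?g x j)"
        using i by (intro sum.mono_neutral_right) (auto simp: y split: if_splits)
      also have "\<dots> = ?D (grid x (i - 1)) w + ?D w (grid x (i + 1))
          - (?D (grid x (i - 1)) (grid x i) + ?D (grid x i) (grid x (i + 1)))"
      proof -
        have "i - 1 \<in> {1..N}" "i \<in> {1..N}" "i + 1 \<in> {1..N}" and ne: "i - 1 \<noteq> i" "i - 1 + 1 = i"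
          using i by auto
        then have "grid y (i - 1) = grid x (i - 1)" "grid y i = w" "grid y (i + 1) = grid x (i + 1)"
          using y by (metis add_eq_self_zero one_neq_zero)+
        then show ?thesis
          by (subst sum.insert) (use ne in \<open>simp_all del: One_nat_def\<close>)
      qed
      \<comment> \<open>One of the two old cells is empty and the other is the whole cell.\<close>
      also have "?D (grid x (i - 1)) (grid x i) + ?D (grid x i) (grid x (i + 1))
          = ?D (grid x (i - 1)) (grid x (i + 1))"
        using neq by auto
      also have "?D (grid x (i - 1)) w + ?D w (grid x (i + 1)) - ?D (grid x (i - 1)) (grid x (i + 1)) < 0"
      proof -
        have "a \<le> grid x (i - 1)" "grid x (i + 1) \<le> b"
          by (rule grid_bounds[OF x]; use i in auto)+
        then show ?thesis using cell_int_err_split[OF r _ w] by simp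
      qed
      finally show False using min[OF \<open>y \<in> T\<close>] by simp
    qed
  qed (use ab N in auto)
  then show ?thesis by (simp add: open_simplex_iff)
qed

text \<open>A minimizer on the compact set \<open>T\<close> lies in the open set \<open>S\<close>,
  where the differential at a minimum is zero.\<close>

lemma ex_grad_zero: "\<exists>x\<in>S. grad x = 0"
proof -
  \<comment> \<open>All inner nodes at \<open>a\<close>: this shows that \<open>T\<close> is
    nonempty.\<close>
  have "(\<chi> k. a) \<in> T" using ab by (auto simp: closed_ordered_simplex_def intro: mono_onI)
  then obtain x where x: "x \<in> T" "\<And>y. y \<in> T \<Longrightarrow> L x \<le> L y"
    using continuous_attains_inf[OF compact_closed_simplex _ continuous_on_error] by blast
  have xS: "x \<in> S" using minimizer_interior[OF x] .
  have "S \<subseteq> T" by (auto simp: open_simplex_iff closed_simplex_iff less_imp_le)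
  then have "(\<lambda>d. d \<bullet> grad x) = (\<lambda>d. 0)"
    using x gderiv_error[OF xS] unfolding gderiv_def
    by (intro differential_zero_maxmin[OF xS open_simplex]) auto
  \<comment> \<open>The zero differential is evaluated in the direction
    \<open>grad x\<close>.\<close>
  then have "grad x \<bullet> grad x = 0" by meson
  then show ?thesis using xS by auto
qed

end

theorem theorem2p1:
  fixes a b r :: real and N :: nat and e :: "nat \<Rightarrow> 'n::finite" and \<mu> :: "real measure"
  assumes "a < b" and "N \<ge> 3" and "r \<ge> 1"
    and "bij_betw e {2..N-1} UNIV"
    and "prob_space \<mu>" and "sets \<mu> = sets borel"
    and "measure \<mu> {a..b} = 1"
    and "\<forall>t. measure \<mu> {t} = 0"
  shows
    "(\<forall>x \<in> ordered_simplex a b N e. dual_quant_error r a b N e \<mu> differentiable (at x)) \<and>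
     (\<exists>G. continuous_gradient_extension (dual_quant_error r a b N e \<mu>)
            (ordered_simplex a b N e) (closed_ordered_simplex a b N e) G) \<and>
     (\<forall>f :: real \<Rightarrow> real.
        f \<in> borel_measurable borel \<and> \<mu> = density lborel (\<lambda>t. ennreal (f t)) \<and>
        (\<forall>t\<in>{a<..<b}. f t > 0) \<and> concave_on {a<..<b} (\<lambda>t. ln (f t)) \<and>
        (\<forall>t. t \<notin> {a<..<b} \<longrightarrow> f t = 0) \<longrightarrow>
        (\<forall>G. continuous_gradient_extension (dual_quant_error r a b N e \<mu>)
               (ordered_simplex a b N e) (closed_ordered_simplex a b N e) G \<longrightarrow>
           (\<exists>xstar \<in> ordered_simplex a b N e.
              {x \<in> closed_ordered_simplex a b N e. G x = 0} = {xstar})))"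
proof -
  interpret prob_space \<mu> by fact
  interpret quantization_grid \<mu> a b r N e
    by unfold_locales (use assms in auto)
  have S_T: "S \<subseteq> T" by (auto simp: open_simplex_iff closed_simplex_iff less_imp_le)
  have "\<forall>x\<in>S. L differentiable (at x)"
    using gderiv_error unfolding gderiv_def differentiable_def by blast
  moreover have "continuous_gradient_extension L S T grad"
    using gderiv_error continuous_on_grad by (simp add: continuous_gradient_extension_def)
  moreover have "\<exists>xstar\<in>S. {x \<in> T. G x = 0} = {xstar}"
    if f: "f \<in> borel_measurable borel \<and> \<mu> = density lborel (\<lambda>t. ennreal (f t)) \<and>
        (\<forall>t\<in>{a<..<b}. f t > 0) \<and> concave_on {a<..<b} (\<lambda>t. ln (f t)) \<and>
        (\<forall>t. t \<notin> {a<..<b} \<longrightarrow> f t = 0)"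
      and G: "continuous_gradient_extension L S T G" for f G
  proof -
    interpret log_concave_grid \<mu> a b r N e f
      by unfold_locales (use f in auto)
    obtain x where x: "x \<in> S" "grad x = 0" using ex_grad_zero by blast
    have "{y \<in> T. G y = 0} = {x}"
    proof (intro equalityI subsetI)
      fix y assume "y \<in> {y \<in> T. G y = 0}"
      \<comment> \<open>An arbitrary extension \<open>G\<close> equals \<open>grad\<close> on
        \<open>T\<close>, so its zeros there are those of \<open>grad\<close>.\<close>
      then have "y \<in> T" "grad y = 0" by (simp_all add: gradient_extension_eq[OF G, symmetric])
      then show "y \<in> {x}" using grad_zero_unique[of y x] x S_T by blast
    next
      fix y assume "y \<in> {x}"
      moreover have "x \<in> T" using x S_T by blast
      ultimately show "y \<in> {y \<in> T. G y = 0}" using x by (simp add: gradient_extension_eq[OF G])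
    qed
    then show ?thesis using x by blast
  qed
  ultimately show ?thesis by blast
qed

end
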